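(* Let $n,k,m\in\mathbb N$, $p_1,\dots,p_n\in\mathbb N$, let $R=[r_1\dots r_k]^T$ and $\Lambda=[\lambda_1\dots\lambda_m]^T$ with all $r_i,\lambda_i\in\mathbb N$, and let $H=[h_1\dots h_m]^T$ with $h_1,\dots,h_m\in\{2,\dots,n\}$ distinct. Then $\Lambda K^H_{p_1,\dots,p_n}$ is $R$-factorizable if and only if $p_1=\dots=p_n=:p$, $\sum_{i=1}^k r_i=\sum_{i=1}^m\lambda_i\binom{n-1}{h_i-1}p^{h_i-1}$, and there exists a non-negative integer matrix $A=[a_{ij}]_{k\times m}$ such that $AH=npR$ and $\sum_{i=1}^k a_{ij}=\lambda_j\binom{n}{h_j}p^{h_j}$ for $1\le j\le m$.
   Context: $\Lambda K^H_{p_1,\dots,p_n}$ is the hypergraph with vertex set partitioned into parts $V_1,\dots,V_n$ with $|V_i|=p_i$, in which, for each $1\le i\le m$ and each set of $h_i$ vertices containing at most one vertex from each part, there are exactly $\lambda_i$ edges of size $h_i$ joining exactly those vertices (one hinge per vertex); there are no other edges. The degree of a vertex is the number of edge incidences at it. An $r$-factor is an $r$-regular spanning sub-hypergraph. An $R$-factorization is a partition $\{F_1,\dots,F_k\}$ of the edge set such that $F_i$ (with all vertices) is an $r_i$-factor for $1\le i\le k$. *)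

theory Defs
  imports "HOL-Library.Multiset" "HOL-Library.Disjoint_Sets"
begin

(* Edges have an identity of their own, so parallel edges are allowed.  The multiset
   hinges G e contains a vertex once for every hinge joining that vertex to e. *)
record ('v, 'e) hypergraph =
  hverts :: "'v set"
  hedges :: "'e set"
  hinges :: "'e \<Rightarrow> 'v multiset"

definition finite_hypergraph :: "('v, 'e) hypergraph \<Rightarrow> bool" where
  "finite_hypergraph G \<longleftrightarrow>
     finite (hverts G) \<and> finite (hedges G) \<and> (\<forall>e\<in>hedges G. set_mset (hinges G e) \<subseteq> hverts G)"

(* Meaningful for finite edge sets only. *)
definition hdegree :: "('v, 'e) hypergraph \<Rightarrow> 'v \<Rightarrow> nat" where
  "hdegree G v = (\<Sum>e\<in>hedges G. count (hinges G e) v)"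

definition hregular :: "nat \<Rightarrow> ('v, 'e) hypergraph \<Rightarrow> bool" where
  "hregular r G \<longleftrightarrow> (\<forall>v\<in>hverts G. hdegree G v = r)"

(* A spanning sub-hypergraph keeps all vertices, so it is determined by its edge set F. *)
definition is_factor :: "('v, 'e) hypergraph \<Rightarrow> nat \<Rightarrow> 'e set \<Rightarrow> bool" where
  "is_factor G r F \<longleftrightarrow> F \<subseteq> hedges G \<and> hregular r (G\<lparr>hedges := F\<rparr>)"

(* The classes are indexed, since F i must be an (r i)-factor.  When r i > 0 and G has a
   vertex, every F i is automatically nonempty, so this is a partition in the strict sense. *)
definition factorization ::
    "('v, 'e) hypergraph \<Rightarrow> nat \<Rightarrow> (nat \<Rightarrow> nat) \<Rightarrow> (nat \<Rightarrow> 'e set) \<Rightarrow> bool" where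
  "factorization G k r F \<longleftrightarrow>
     (\<Union>i\<in>{1..k}. F i) = hedges G \<and> disjoint_family_on F {1..k} \<and>
     (\<forall>i\<in>{1..k}. is_factor G (r i) (F i))"

definition factorizable :: "('v, 'e) hypergraph \<Rightarrow> nat \<Rightarrow> (nat \<Rightarrow> nat) \<Rightarrow> bool" where
  "factorizable G k r \<longleftrightarrow> (\<exists>F. factorization G k r F)"

definition part :: "(nat \<Rightarrow> nat) \<Rightarrow> nat \<Rightarrow> (nat \<times> nat) set" where
  "part p i = {i} \<times> {1..p i}"

definition multipartite_verts :: "nat \<Rightarrow> (nat \<Rightarrow> nat) \<Rightarrow> (nat \<times> nat) set" where
  "multipartite_verts n p = (\<Union>i\<in>{1..n}. part p i)"

(* The edge (j, S, c) is the c-th of the lam j parallel edges of size h j on the vertex set S. *)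
definition complete_multipartite ::
    "nat \<Rightarrow> (nat \<Rightarrow> nat) \<Rightarrow> nat \<Rightarrow> (nat \<Rightarrow> nat) \<Rightarrow> (nat \<Rightarrow> nat) \<Rightarrow>
     (nat \<times> nat, nat \<times> (nat \<times> nat) set \<times> nat) hypergraph" where
  "complete_multipartite n p m h lam =
     \<lparr> hverts = multipartite_verts n p,
       hedges = {(j, S, c). j \<in> {1..m} \<and> S \<subseteq> multipartite_verts n p \<and> card S = h j \<and>
                   (\<forall>i\<in>{1..n}. card (S \<inter> part p i) \<le> 1) \<and> c \<in> {1..lam j}},
       hinges = (\<lambda>(j, S, c). mset_set S) \<rparr>"

lemma finite_multipartite_verts: "finite (multipartite_verts n p)"
  by (simp add: multipartite_verts_def part_def)

lemma finite_complete_multipartite: "finite_hypergraph (complete_multipartite n p m h lam)"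
proof -
  let ?V = "multipartite_verts n p"
  have "hedges (complete_multipartite n p m h lam) \<subseteq> (SIGMA j:{1..m}. Pow ?V \<times> {1..lam j})"
    by (auto simp: complete_multipartite_def)
  moreover have "finite (SIGMA j:{1..m}. Pow ?V \<times> {1..lam j})"
    using finite_multipartite_verts by auto
  ultimately have "finite (hedges (complete_multipartite n p m h lam))"
    by (rule finite_subset)
  moreover have "set_mset (mset_set S) \<subseteq> ?V" if "S \<subseteq> ?V" for S
    using that finite_subset[OF that finite_multipartite_verts] by simp
  ultimately show ?thesis
    using finite_multipartite_verts
    by (auto simp: finite_hypergraph_def complete_multipartite_def)
qed

end

theory Submission
  imports Defs Complex_Main "HOL-Library.FuncSet"
begin

text \<open>
  Sufficiency is proved in the manner of Baranyai's theorem. The matrix \<open>A\<close> supplies abstract edges,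
  each with a colour and a size but without vertices, so that every colour has total size \<open>n q r\<close>.
  First the parts \<open>1, \<dots>, n\<close> are treated one at a time: an edge that still lacks \<open>a\<close> of its parts joins
  the next one, out of \<open>N\<close> remaining, with weight \<open>a / N\<close>. These weights have integral sums both over
  each colour and over each class of edges with the same size and the same parts so far, hence
  can be rounded to \<open>0\<close> and \<open>1\<close> without changing any of these sums. Then each part is split into its
  \<open>q\<close> vertices by rounding the constant weight \<open>1 / q\<close> repeatedly.

  Conversely, a factorization makes all vertex degrees equal. The degrees of vertices in parts \<open>i\<close>
  and \<open>i'\<close> differ by a positive multiple of \<open>p i' - p i\<close>, so the parts have equal sizes,
  and \<open>A\<close> counts the edges of each size in each factor.
\<close>

section \<open>Rounding with respect to two partitions\<close>

text \<open>Gaussian elimination, one equation at a time. An equation without nonzero coefficients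
  is dropped; otherwise it is solved for one unknown \<open>e0\<close>, which leaves a system with
  one equation and one unknown fewer.\<close>

lemma homogeneous_system_nontrivial:
  fixes a :: "'i \<Rightarrow> 'e \<Rightarrow> 'a::field"
  assumes "finite I" "finite E" "card I < card E"
  shows "\<exists>y. (\<exists>e\<in>E. y e \<noteq> 0) \<and> (\<forall>i\<in>I. (\<Sum>e\<in>E. a i e * y e) = 0)"
  using assms
proof (induction I arbitrary: E a rule: finite_induct)
  case empty
  then have "E \<noteq> {}" by auto
  then show ?case by (intro exI[of _ "\<lambda>_. 1"]) auto
next
  case (insert i I)
  show ?case
  proof (cases "\<forall>e\<in>E. a i e = 0")
    case True
    obtain y where "\<exists>e\<in>E. y e \<noteq> 0" "\<forall>i\<in>I. (\<Sum>e\<in>E. a i e * y e) = 0"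
      using insert.IH[of E a] insert.hyps insert.prems by (auto simp: Suc_lessD)
    with True show ?thesis by (intro exI[of _ y]) auto
  next
    case False
    then obtain e0 where e0: "e0 \<in> E" "a i e0 \<noteq> 0" by auto
    define E' where "E' = E - {e0}"
    have E': "finite E'" "e0 \<notin> E'" "E = insert e0 E'" and "card I < card E'"
      using insert.prems insert.hyps e0 by (auto simp: E'_def)
    then obtain y where y: "\<exists>e\<in>E'. y e \<noteq> 0"
      "\<And>i'. i' \<in> I \<Longrightarrow> (\<Sum>e\<in>E'. (a i' e - a i' e0 * a i e / a i e0) * y e) = 0"
      using insert.IH[of E' "\<lambda>i' e. a i' e - a i' e0 * a i e / a i e0"] by auto
    define s where "s = (\<Sum>e\<in>E'. a i e * y e)"
    \<comment> \<open>Back substitution: the value at \<open>e0\<close> is the one that makes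
      equation \<open>i\<close> hold.\<close>
    define z where "z = y(e0 := - s / a i e0)"
    have zsum: "(\<Sum>e\<in>E. a i' e * z e) = (\<Sum>e\<in>E'. a i' e * y e) - a i' e0 * s / a i e0" for i'
    proof -
      have "(\<Sum>e\<in>E'. a i' e * z e) = (\<Sum>e\<in>E'. a i' e * y e)"
        using E'(2) by (intro sum.cong) (auto simp: z_def)
      with E' show ?thesis by (simp add: z_def)
    qed
    have "(\<Sum>e\<in>E. a i' e * z e) = 0" if "i' \<in> I" for i'
      using y(2)[OF that] unfolding zsum s_def
      by (simp add: algebra_simps sum_subtractf sum_distrib_left sum_divide_distrib)
    moreover have "(\<Sum>e\<in>E. a i e * z e) = 0"
      using e0 unfolding zsum s_def by simp
    moreover have "\<exists>e\<in>E. z e \<noteq> 0"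
      using y(1) E' by (auto simp: z_def)
    ultimately show ?thesis by blast
  qed
qed

text \<open>Every nonempty fibre of \<open>f\<close> on \<open>S\<close> has at least two
  elements.\<close>

lemma card_image_le_half:
  assumes "finite S" "\<And>e. e \<in> S \<Longrightarrow> \<exists>e'\<in>S. e' \<noteq> e \<and> f e' = f e"
  shows "2 * card (f ` S) \<le> card S"
proof -
  have "2 * card (f ` S) = (\<Sum>i\<in>f ` S. 2)" by simp
  also have "\<dots> \<le> (\<Sum>i\<in>f ` S. card {e \<in> S. f e = i})"
  proof (rule sum_mono)
    fix i assume "i \<in> f ` S"
    then obtain e where e: "e \<in> S" "f e = i" by auto
    then obtain e' where e': "e' \<in> S" "e' \<noteq> e" "f e' = f e" using assms(2) by blast
    have "card {e, e'} \<le> card {e \<in> S. f e = i}"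
      using e e' assms(1) by (intro card_mono) auto
    then show "2 \<le> card {e \<in> S. f e = i}" using e' by simp
  qed
  also have "\<dots> = card S"
    using sum.image_gen[OF assms(1), of "\<lambda>_. 1 :: nat" f] by simp
  finally show ?thesis .
qed

text \<open>If \<open>x e\<close> were the only fractional value in its fibre, it would be the
  difference of two integers: the sum over the fibre and the sum over the rest of it.\<close>

lemma fractional_fibre_partner:
  fixes x :: "'e \<Rightarrow> real"
  assumes "finite E" "sum x {e'\<in>E. f e' = f e} \<in> \<int>" "e \<in> E" "x e \<notin> \<int>"
  shows "\<exists>e'\<in>{e\<in>E. x e \<notin> \<int>}. e' \<noteq> e \<and> f e' = f e"
proof (rule ccontr)
  define S where "S = {e'\<in>E. f e' = f e}"
  assume "\<not> ?thesis"
  then have "sum x (S - {e}) \<in> \<int>" by (intro Ints_sum) (auto simp: S_def)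
  moreover have "x e = sum x S - sum x (S - {e})"
    using assms by (simp add: S_def sum_diff1)
  ultimately show False using assms(2,4) by (metis Ints_diff S_def)
qed

lemma balanced_perturbation:
  fixes c :: "'e \<Rightarrow> 'c" and d :: "'e \<Rightarrow> 'd"
  assumes "finite S" "S \<noteq> {}"
    and "\<forall>e\<in>S. \<exists>e'\<in>S. e' \<noteq> e \<and> c e' = c e"
    and "\<forall>e\<in>S. \<exists>e'\<in>S. e' \<noteq> e \<and> d e' = d e"
  shows "\<exists>y :: 'e \<Rightarrow> real. (\<exists>e\<in>S. y e \<noteq> 0) \<and> (\<forall>i. sum y {e\<in>S. c e = i} = 0) \<and>
    (\<forall>j. sum y {e\<in>S. d e = j} = 0)"
proof -
  obtain e0 where e0: "e0 \<in> S" using assms by auto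
  define I where "I = (c ` S <+> d ` S) - {Inl (c e0)}"
  \<comment> \<open>The incidence matrix of classes and elements. The sum type keeps the classes of
    \<open>c\<close> apart from those of \<open>d\<close>.\<close>
  define a :: "'c + 'd \<Rightarrow> 'e \<Rightarrow> real"
    where "a = case_sum (\<lambda>i e. of_bool (c e = i)) (\<lambda>j e. of_bool (d e = j))"
  have "card (c ` S <+> d ` S) \<le> card S"
    using card_image_le_half[of S c] card_image_le_half[of S d] assms
    by (simp add: card_Plus)
  moreover have "Inl (c e0) \<in> c ` S <+> d ` S" using e0 by auto
  moreover have "finite (c ` S <+> d ` S)" using assms(1) by simp
  ultimately have "finite I" "card I < card S"
    unfolding I_def using card_Diff1_less[of "c ` S <+> d ` S" "Inl (c e0)"] by auto
  then obtain y where y: "\<exists>e\<in>S. y e \<noteq> 0" "\<And>i. i \<in> I \<Longrightarrow> (\<Sum>e\<in>S. a i e * y e) = 0"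
    using homogeneous_system_nontrivial[of I S a] assms(1) by auto
  have fib: "(\<Sum>e\<in>S. of_bool (P e) * y e) = sum y {e\<in>S. P e}" for P
    unfolding sum.inter_filter[OF assms(1)] by (intro sum.cong) auto
  have d0: "sum y {e\<in>S. d e = j} = 0" for j
  proof (cases "j \<in> d ` S")
    case True
    then show ?thesis using y(2)[of "Inr j"] by (auto simp: I_def a_def fib)
  next
    case False
    then have "{e\<in>S. d e = j} = {}" by auto
    then show ?thesis by (metis sum.empty)
  qed
  have c1: "sum y {e\<in>S. c e = i} = 0" if "i \<noteq> c e0" for i
  proof (cases "i \<in> c ` S")
    case True
    then show ?thesis using y(2)[of "Inl i"] that by (auto simp: I_def a_def fib)
  next
    case False
    then have "{e\<in>S. c e = i} = {}" by auto
    then show ?thesis by (metis sum.empty)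
  qed
  \<comment> \<open>The omitted equation follows, because both families of fibres add up to the total sum.\<close>
  have "0 = sum y S"
    using sum.image_gen[OF assms(1), of y d] d0 by simp
  also have "\<dots> = (\<Sum>i\<in>c ` S. sum y {e\<in>S. c e = i})"
    using assms(1) by (rule sum.image_gen)
  also have "\<dots> = sum y {e\<in>S. c e = c e0} + (\<Sum>i\<in>c ` S - {c e0}. sum y {e\<in>S. c e = i})"
    using assms(1) e0 by (intro sum.remove) auto
  also have "\<dots> = sum y {e\<in>S. c e = c e0}"
    using c1 by simp
  finally have "sum y {e\<in>S. c e = i} = 0" for i
    using c1[of i] by (cases "i = c e0") auto
  with y(1) d0 show ?thesis by blast
qed

text \<open>If the classes of \<open>c\<close> and \<open>d\<close> are the two sides of a bipartite
  graph with edge set \<open>E\<close>, this is the integrality of the polytope of edge weights with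
  prescribed integral vertex sums. A point with fractional entries is moved along a perturbation
  that keeps all class sums and all integral entries, until another entry becomes integral; the
  number of fractional entries decreases.\<close>

lemma integral_rounding:
  fixes x :: "'e \<Rightarrow> real"
  assumes "finite E" "\<And>e. e \<in> E \<Longrightarrow> 0 \<le> x e \<and> x e \<le> 1"
    and "\<And>i. sum x {e\<in>E. c e = i} \<in> \<int>" "\<And>j. sum x {e\<in>E. d e = j} \<in> \<int>"
  shows "\<exists>X\<subseteq>E. (\<forall>i. real (card {e\<in>X. c e = i}) = sum x {e\<in>E. c e = i}) \<and>
    (\<forall>j. real (card {e\<in>X. d e = j}) = sum x {e\<in>E. d e = j})"
  using assms
proof (induction "card {e\<in>E. x e \<notin> \<int>}" arbitrary: x rule: less_induct)
  case less
  define S where "S = {e\<in>E. x e \<notin> \<int>}"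
  have S: "finite S" "S \<subseteq> E" using assms(1) by (auto simp: S_def)
  show ?case
  proof (cases "S = {}")
    case True
    have 01: "x e = 0 \<or> x e = 1" if "e \<in> E" for e
    proof -
      have "x e \<in> \<int>" using True that by (auto simp: S_def)
      then obtain z where "x e = of_int z" by (auto elim: Ints_cases)
      with less.prems(2)[OF that] show ?thesis by (cases "z = 0") auto
    qed
    have "real (card {e\<in>{e\<in>E. x e = 1}. P e}) = sum x {e\<in>E. P e}" for P
    proof -
      have "sum x {e\<in>E. P e} = (\<Sum>e\<in>{e\<in>E. P e}. if x e = 1 then 1 else 0)"
        using 01 by (intro sum.cong) auto
      also have "\<dots> = real (card {e\<in>{e\<in>E. P e}. x e = 1})"
        using assms(1) by (simp flip: sum.inter_filter)
      also have "{e\<in>{e\<in>E. P e}. x e = 1} = {e\<in>{e\<in>E. x e = 1}. P e}" by auto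
      finally show ?thesis by simp
    qed
    then show ?thesis by (intro exI[of _ "{e\<in>E. x e = 1}"]) auto
  next
    case False
    have c2: "\<forall>e\<in>S. \<exists>e'\<in>S. e' \<noteq> e \<and> c e' = c e"
      using fractional_fibre_partner[OF assms(1) less.prems(3)] by (auto simp: S_def)
    have d2: "\<forall>e\<in>S. \<exists>e'\<in>S. e' \<noteq> e \<and> d e' = d e"
      using fractional_fibre_partner[OF assms(1) less.prems(4)] by (auto simp: S_def)
    obtain y :: "'e \<Rightarrow> real" where y: "\<exists>e\<in>S. y e \<noteq> 0" "\<And>i. sum y {e\<in>S. c e = i} = 0"
      "\<And>j. sum y {e\<in>S. d e = j} = 0"
      using balanced_perturbation[OF S(1) False c2 d2] by blast
    have frac: "0 < x e" "x e < 1" if "e \<in> S" for e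
      using that less.prems(2)[of e] by (auto simp: S_def less_le)
    \<comment> \<open>the largest step along \<open>y\<close> that stays in the unit cube\<close>
    define b where "b e = (if y e > 0 then (1 - x e) / y e else x e / (- y e))" for e
    define t where "t = Min (b ` {e\<in>S. y e \<noteq> 0})"
    have finy: "finite (b ` {e\<in>S. y e \<noteq> 0})" "b ` {e\<in>S. y e \<noteq> 0} \<noteq> {}"
      using S y(1) by auto
    obtain e1 where e1: "e1 \<in> S" "y e1 \<noteq> 0" "t = b e1"
      using Min_in[OF finy] by (auto simp: t_def)
    have t_le: "t \<le> b e" if "e \<in> S" "y e \<noteq> 0" for e
      unfolding t_def using finy that by (intro Min_le) auto
    have "0 \<le> t" using e1 frac[of e1] by (auto simp: b_def divide_simps)
    define x' where "x' e = (if e \<in> S then x e + t * y e else x e)" for e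
    have x'01: "0 \<le> x' e \<and> x' e \<le> 1" if "e \<in> E" for e
    proof (cases "e \<in> S \<and> y e \<noteq> 0")
      case True
      then consider "y e > 0" | "y e < 0" by linarith
      then show ?thesis
      proof cases
        case 1
        then have "t * y e \<le> 1 - x e" "0 \<le> t * y e"
          using t_le[of e] True \<open>0 \<le> t\<close> by (auto simp: b_def pos_le_divide_eq)
        then show ?thesis using True frac[of e] by (auto simp: x'_def)
      next
        case 2
        then have "t * (- y e) \<le> x e" "0 \<le> t * (- y e)"
          using t_le[of e] True pos_le_divide_eq[of "- y e" t "x e"] \<open>0 \<le> t\<close>
          by (auto simp: b_def mult_nonneg_nonpos)
        then show ?thesis using True frac[of e] by (auto simp: x'_def)
      qed
    next
      case False
      then show ?thesis using less.prems(2)[OF that] by (auto simp: x'_def)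
    qed
    have x'sum: "sum x' {e\<in>E. P e} = sum x {e\<in>E. P e}" if "sum y {e\<in>S. P e} = 0" for P
    proof -
      have fin: "finite {e\<in>E. P e}" using assms(1) by simp
      have "sum x' {e\<in>E. P e} = (\<Sum>e\<in>{e\<in>E. P e}. x e + (if e \<in> S then t * y e else 0))"
        by (intro sum.cong) (auto simp: x'_def)
      also have "\<dots> = sum x {e\<in>E. P e} + (\<Sum>e\<in>{e\<in>{e\<in>E. P e}. e \<in> S}. t * y e)"
        unfolding sum.distrib sum.inter_filter[OF fin] ..
      also have "{e\<in>{e\<in>E. P e}. e \<in> S} = {e\<in>S. P e}" using S by auto
      finally show ?thesis using that by (simp flip: sum_distrib_left)
    qed
    \<comment> \<open>The entry that limits the step ends at 0 or 1. Entries outside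
      \<open>S\<close> are unchanged, so no new fractional entry arises.\<close>
    have "x' e1 \<in> \<int>"
      using e1 by (auto simp: x'_def b_def)
    then have "{e\<in>E. x' e \<notin> \<int>} \<subset> {e\<in>E. x e \<notin> \<int>}"
      using e1 by (auto simp: x'_def S_def split: if_splits)
    then have "card {e\<in>E. x' e \<notin> \<int>} < card {e\<in>E. x e \<notin> \<int>}"
      using assms(1) by (intro psubset_card_mono) auto
    from less.hyps[OF this assms(1) x'01] show ?thesis
      using less.prems(3,4) y(2,3) by (simp add: x'sum)
  qed
qed

text \<open>The groups are split off one at a time. With \<open>Suc q\<close> groups to be formed,
  the constant weight \<open>1 / Suc q\<close> has class sums \<open>\<gamma> i\<close> and
  \<open>\<delta> j\<close>, so rounding it gives one group; what remains satisfies the hypotheses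
  for \<open>q\<close>.\<close>

lemma equitable_split:
  assumes "finite E"
    and "\<And>i. card {e\<in>E. c e = i} = q * \<gamma> i" "\<And>j. card {e\<in>E. d e = j} = q * \<delta> j"
  shows "\<exists>g. (\<forall>e\<in>E. g e \<in> {1..q}) \<and>
    (\<forall>u\<in>{1..q}. (\<forall>i. card {e\<in>E. c e = i \<and> g e = u} = \<gamma> i) \<and>
                 (\<forall>j. card {e\<in>E. d e = j \<and> g e = u} = \<delta> j))"
  using assms
proof (induction q arbitrary: E)
  case 0
  have "E = {}"
  proof (rule ccontr)
    assume "E \<noteq> {}"
    then obtain e where "e \<in> E" by blast
    then show False using 0(2)[of "c e"] 0(1) by auto
  qed
  then show ?case by simp
next
  case (Suc q)
  obtain X where X: "X \<subseteq> E"
    "\<And>i. real (card {e\<in>X. c e = i}) = (\<Sum>e\<in>{e\<in>E. c e = i}. 1 / Suc q)"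
    "\<And>j. real (card {e\<in>X. d e = j}) = (\<Sum>e\<in>{e\<in>E. d e = j}. 1 / Suc q)"
    using integral_rounding[of E "\<lambda>_. 1 / Suc q" c d] Suc.prems
    by (auto simp: field_simps simp del: of_nat_Suc mult_Suc)
  have Xc: "card {e\<in>X. c e = i} = \<gamma> i" for i
    using X(2)[of i] Suc.prems(2)[of i]
    by (simp add: field_simps del: of_nat_Suc mult_Suc)
  have Xd: "card {e\<in>X. d e = j} = \<delta> j" for j
    using X(3)[of j] Suc.prems(3)[of j]
    by (simp add: field_simps del: of_nat_Suc mult_Suc)
  have rest: "card {e\<in>E - X. P e} = card {e\<in>E. P e} - card {e\<in>X. P e}" for P
  proof -
    have "{e\<in>E - X. P e} = {e\<in>E. P e} - {e\<in>X. P e}" by auto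
    then show ?thesis using X(1) Suc.prems(1)
      by (simp, intro card_Diff_subset) (auto intro: finite_subset)
  qed
  have "card {e\<in>E - X. c e = i} = q * \<gamma> i" for i
    unfolding rest Xc Xd Suc.prems by simp
  moreover have "card {e\<in>E - X. d e = j} = q * \<delta> j" for j
    unfolding rest Xc Xd Suc.prems by simp
  ultimately obtain g where g: "\<And>e. e \<in> E - X \<Longrightarrow> g e \<in> {1..q}"
    "\<And>u i. u \<in> {1..q} \<Longrightarrow> card {e\<in>E - X. c e = i \<and> g e = u} = \<gamma> i"
    "\<And>u j. u \<in> {1..q} \<Longrightarrow> card {e\<in>E - X. d e = j \<and> g e = u} = \<delta> j"
    using Suc.IH[OF finite_Diff[OF Suc.prems(1)]] by blast
  define g' where "g' e = (if e \<in> X then Suc q else g e)" for e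
  have top: "{e\<in>E. P e \<and> g' e = Suc q} = {e\<in>X. P e}" for P
  proof -
    have "g e \<noteq> Suc q" if "e \<in> E - X" for e using g(1)[OF that] by simp
    then show ?thesis using X(1) by (auto simp: g'_def)
  qed
  have low: "{e\<in>E. P e \<and> g' e = u} = {e\<in>E - X. P e \<and> g e = u}" if "u \<in> {1..q}" for P u
    using that by (auto simp: g'_def)
  have "card {e\<in>E. c e = i \<and> g' e = u} = \<gamma> i \<and> card {e\<in>E. d e = j \<and> g' e = u} = \<delta> j"
    if "u \<in> {1..Suc q}" for u i j
  proof (cases "u = Suc q")
    case True
    then show ?thesis by (simp add: top Xc Xd)
  next
    case False
    then have "u \<in> {1..q}" using that by auto
    then show ?thesis by (simp only: low g(2,3))
  qed
  moreover have "g' e \<in> {1..Suc q}" if "e \<in> E" for e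
    using g(1)[of e] that by (auto simp: g'_def)
  ultimately show ?case by (intro exI[of _ g']) blast
qed

section \<open>Distributing abstract edges over parts and vertices\<close>

lemma sum_card_Int_eq:
  assumes "finite E" "finite A"
  shows "(\<Sum>e\<in>E. card (T e \<inter> A)) = (\<Sum>a\<in>A. card {e\<in>E. a \<in> T e})"
proof -
  have "(\<Sum>e\<in>E. card (T e \<inter> A)) = (\<Sum>e\<in>E. \<Sum>a\<in>A. of_bool (a \<in> T e))"
    using assms by (intro sum.cong) (auto simp: Int_commute)
  also have "\<dots> = (\<Sum>a\<in>A. \<Sum>e\<in>E. of_bool (a \<in> T e))" by (rule sum.swap)
  also have "\<dots> = (\<Sum>a\<in>A. card {e\<in>E. a \<in> T e})"
    using assms by (intro sum.cong) (auto simp: Int_def)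
  finally show ?thesis .
qed

text \<open>The invariant describes the state after \<open>t\<close> parts, where \<open>T e\<close>
  holds the parts that \<open>e\<close> has joined. Each colour has met each treated part
  \<open>D l\<close> times. The edges of type \<open>j\<close> with trace \<open>S\<close> are as
  numerous as they must be in the end: \<open>S\<close> extends to
  \<open>(n - t) choose (h j - card S)\<close> part sets of size \<open>h j\<close>, each to be used
  \<open>M j\<close> times.\<close>

lemma parts_assignment_upto:
  fixes \<kappa> :: "'e \<Rightarrow> 'c" and \<tau> :: "'e \<Rightarrow> 't"
  assumes "finite E"
    and colour: "\<And>l. (\<Sum>e\<in>{e\<in>E. \<kappa> e = l}. h (\<tau> e)) = n * D l"
    and type: "\<And>j. card {e\<in>E. \<tau> e = j} = M j * (n choose h j)"
    and "t \<le> n"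
  shows "\<exists>T. (\<forall>e\<in>E. T e \<subseteq> {1..t} \<and> card (T e) \<le> h (\<tau> e)) \<and>
    (\<forall>l. \<forall>i\<in>{1..t}. card {e\<in>E. \<kappa> e = l \<and> i \<in> T e} = D l) \<and>
    (\<forall>j S. S \<subseteq> {1..t} \<longrightarrow> card S \<le> h j \<longrightarrow>
      card {e\<in>E. \<tau> e = j \<and> T e = S} = M j * ((n - t) choose (h j - card S)))"
  using \<open>t \<le> n\<close>
proof (induction t)
  case 0
  show ?case using type by (intro exI[of _ "\<lambda>_. {}"]) auto
next
  case (Suc t)
  define N where "N = n - t"
  have N: "N > 0" "n - Suc t = N - 1" using Suc.prems by (auto simp: N_def)
  obtain T where IH: "\<forall>e\<in>E. T e \<subseteq> {1..t} \<and> card (T e) \<le> h (\<tau> e)"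
    "\<forall>l. \<forall>i\<in>{1..t}. card {e\<in>E. \<kappa> e = l \<and> i \<in> T e} = D l"
    "\<forall>j S. S \<subseteq> {1..t} \<longrightarrow> card S \<le> h j \<longrightarrow>
      card {e\<in>E. \<tau> e = j \<and> T e = S} = M j * (N choose (h j - card S))"
    using Suc.IH Suc_leD[OF Suc.prems] unfolding N_def by blast
  have T: "T e \<subseteq> {1..t}" "card (T e) \<le> h (\<tau> e)" if "e \<in> E" for e
    using IH(1) that by auto
  have Tc: "i \<in> {1..t} \<Longrightarrow> card {e\<in>E. \<kappa> e = l \<and> i \<in> T e} = D l" for l i
    using IH(2) by blast
  have Tt: "S \<subseteq> {1..t} \<Longrightarrow> card S \<le> h j \<Longrightarrow>
      card {e\<in>E. \<tau> e = j \<and> T e = S} = M j * (N choose (h j - card S))" for j S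
    using IH(3) by blast
  \<comment> \<open>The number of parts that \<open>e\<close> still lacks.\<close>
  define w where "w e = h (\<tau> e) - card (T e)" for e
  \<comment> \<open>The number of edges of type \<open>j\<close> and trace \<open>S\<close> that are
    to join part \<open>Suc t\<close>. It comes from the absorption identity
    \<open>a * (N choose a) = N * ((N - 1) choose (a - 1))\<close>. The case
    \<open>card S = h j\<close> is separate because truncated subtraction would yield the binomial
    coefficient 1 instead of 0.\<close>
  define s where "s j S = M j * (if card S < h j then (N - 1) choose (h j - card S - 1) else 0)" for j and S :: "nat set"
  have "w e \<le> N" if "e \<in> E" for e
  proof -
    \<comment> \<open>Since \<open>e\<close> belongs to its own class, the binomial coefficient that
      counts this class is nonzero, which bounds \<open>w e\<close> by \<open>N\<close>.\<close>
    have "card {e'\<in>E. \<tau> e' = \<tau> e \<and> T e' = T e} \<noteq> 0" using that assms(1) by auto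
    then have "N choose w e \<noteq> 0" using Tt[OF T[OF that]] by (auto simp: w_def)
    then show ?thesis by (meson binomial_eq_0 not_le)
  qed
  then have x01: "0 \<le> real (w e) / N \<and> real (w e) / N \<le> 1" if "e \<in> E" for e
    using that N by auto
  \<comment> \<open>Of the total size \<open>n * D l\<close> of colour \<open>l\<close>, the first
    \<open>t\<close> parts have used \<open>t * D l\<close>. The edges of this colour therefore lack
    \<open>N * D l\<close> parts altogether.\<close>
  have csum: "(\<Sum>e\<in>{e\<in>E. \<kappa> e = l}. real (w e) / N) = D l" for l
  proof -
    have "(\<Sum>e\<in>{e\<in>E. \<kappa> e = l}. card (T e)) = (\<Sum>e\<in>{e\<in>E. \<kappa> e = l}. card (T e \<inter> {1..t}))"
      using T by (intro sum.cong) (auto simp: Int_absorb2)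
    also have "\<dots> = (\<Sum>i\<in>{1..t}. card {e\<in>{e\<in>E. \<kappa> e = l}. i \<in> T e})"
      using assms(1) by (intro sum_card_Int_eq) auto
    also have "\<dots> = (\<Sum>i\<in>{1..t}. D l)"
      using Tc by (intro sum.cong) auto
    finally have "(\<Sum>e\<in>{e\<in>E. \<kappa> e = l}. w e) + t * D l = (\<Sum>e\<in>{e\<in>E. \<kappa> e = l}. w e + card (T e))"
      by (simp add: sum.distrib)
    also have "\<dots> = n * D l"
      unfolding colour[symmetric] using T(2) by (intro sum.cong) (auto simp: w_def)
    finally have "(\<Sum>e\<in>{e\<in>E. \<kappa> e = l}. w e) = N * D l"
      by (simp add: N_def diff_mult_distrib)
    then show ?thesis
      using N by (simp add: sum_divide_distrib[symmetric] of_nat_sum[symmetric] del: of_nat_sum)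
  qed
  have dsum: "(\<Sum>e\<in>{e\<in>E. (\<tau> e, T e) = (j, S)}. real (w e) / N) = s j S"
    if "S \<subseteq> {1..t}" "card S \<le> h j" for j S
  proof -
    have "(\<Sum>e\<in>{e\<in>E. (\<tau> e, T e) = (j, S)}. real (w e) / N) =
      real (card {e\<in>E. \<tau> e = j \<and> T e = S}) * (real (h j - card S) / N)"
      by (simp add: w_def)
    also have "\<dots> = real (M j * ((h j - card S) * (N choose (h j - card S)))) / N"
      using Tt[OF that] by (simp add: mult_ac)
    also have "(h j - card S) * (N choose (h j - card S)) =
      N * (if card S < h j then (N - 1) choose (h j - card S - 1) else 0)"
      using times_binomial_minus1_eq[of "h j - card S" N] by auto
    finally show ?thesis using N by (simp add: s_def)
  qed
  have "(\<Sum>e\<in>{e\<in>E. (\<tau> e, T e) = a}. real (w e) / N) \<in> \<int>" for a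
  proof (cases "{e\<in>E. (\<tau> e, T e) = a} = {}")
    case True
    then show ?thesis by (metis Ints_0 sum.empty)
  next
    case False
    then obtain e where e: "e \<in> E" "a = (\<tau> e, T e)" by auto
    show ?thesis unfolding e(2) dsum[OF T[OF e(1)]] by (rule Ints_of_nat)
  qed
  moreover have "(\<Sum>e\<in>{e\<in>E. \<kappa> e = l}. real (w e) / N) \<in> \<int>" for l
    unfolding csum by (rule Ints_of_nat)
  ultimately have "\<exists>X\<subseteq>E.
    (\<forall>l. real (card {e\<in>X. \<kappa> e = l}) = (\<Sum>e\<in>{e\<in>E. \<kappa> e = l}. real (w e) / N)) \<and>
    (\<forall>a. real (card {e\<in>X. (\<tau> e, T e) = a}) = (\<Sum>e\<in>{e\<in>E. (\<tau> e, T e) = a}. real (w e) / N))"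
    by (intro integral_rounding assms(1) x01)
  then obtain X where X: "X \<subseteq> E"
    "\<forall>l. real (card {e\<in>X. \<kappa> e = l}) = (\<Sum>e\<in>{e\<in>E. \<kappa> e = l}. real (w e) / N)"
    "\<forall>a. real (card {e\<in>X. (\<tau> e, T e) = a}) = (\<Sum>e\<in>{e\<in>E. (\<tau> e, T e) = a}. real (w e) / N)"
    by blast
  have Xc: "card {e\<in>X. \<kappa> e = l} = D l" for l
    using X(2)[rule_format, of l] unfolding csum of_nat_eq_iff .
  have Xt: "card {e\<in>X. \<tau> e = j \<and> T e = S} = s j S" if "S \<subseteq> {1..t}" "card S \<le> h j" for j S
    using X(3)[rule_format, of "(j, S)"] unfolding dsum[OF that] of_nat_eq_iff by simp
  have finX: "finite X" using X(1) assms(1) by (rule finite_subset)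
  \<comment> \<open>Complete edges have weight 0, and \<open>s\<close> vanishes on their classes, so
    none of them is chosen.\<close>
  have X_less: "card (T e) < h (\<tau> e)" if "e \<in> X" for e
  proof -
    have "card {e'\<in>X. \<tau> e' = \<tau> e \<and> T e' = T e} \<noteq> 0" using that finX by auto
    then show ?thesis using Xt[OF T, of e] that X(1) by (auto simp: s_def split: if_splits)
  qed
  have notin: "Suc t \<notin> T e" if "e \<in> E" for e using T(1)[OF that] by auto
  define T' where "T' e = (if e \<in> X then insert (Suc t) (T e) else T e)" for e
  have "T' e \<subseteq> {1..Suc t} \<and> card (T' e) \<le> h (\<tau> e)" if "e \<in> E" for e
    using T[OF that] X_less[of e] notin[OF that] finite_subset[OF T(1)[OF that]]
    by (auto simp: T'_def)
  moreover have "card {e\<in>E. \<kappa> e = l \<and> i \<in> T' e} = D l" if "i \<in> {1..Suc t}" for l i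
  proof (cases "i = Suc t")
    case True
    then have "{e\<in>E. \<kappa> e = l \<and> i \<in> T' e} = {e\<in>X. \<kappa> e = l}"
      using X(1) notin by (auto simp: T'_def)
    then show ?thesis using Xc by simp
  next
    case False
    then have "{e\<in>E. \<kappa> e = l \<and> i \<in> T' e} = {e\<in>E. \<kappa> e = l \<and> i \<in> T e}"
      by (auto simp: T'_def)
    then show ?thesis using Tc[of i l] False that by auto
  qed
  moreover have "card {e\<in>E. \<tau> e = j \<and> T' e = S} = M j * ((n - Suc t) choose (h j - card S))"
    if S: "S \<subseteq> {1..Suc t}" "card S \<le> h j" for j S
  proof (cases "Suc t \<in> S")
    case True
    define S' where "S' = S - {Suc t}"
    have S': "S = insert (Suc t) S'" "Suc t \<notin> S'" "S' \<subseteq> {1..t}"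
      using True S(1) by (auto simp: S'_def)
    then have cS: "card S = Suc (card S')" using finite_subset[OF S'(3)] by auto
    \<comment> \<open>The edges with new trace \<open>S\<close> are the chosen ones with old trace
      \<open>S'\<close>. As \<open>S\<close> has one element more than \<open>S'\<close>, the lower
      index \<open>h j - card S' - 1\<close> in \<open>s j S'\<close> is
      \<open>h j - card S\<close>.\<close>
    have "{e\<in>E. \<tau> e = j \<and> T' e = S} = {e\<in>X. \<tau> e = j \<and> T e = S'}"
      using X(1) notin S'(1,2) by (auto simp: T'_def dest: insert_ident[THEN iffD1, rotated 2])
    then show ?thesis
      using Xt[of S' j] S' cS S(2) by (simp add: s_def N(2))
  next
    case False
    then have S': "S \<subseteq> {1..t}" using S(1) by (auto simp: le_Suc_eq)
    have "{e\<in>E. \<tau> e = j \<and> T' e = S} =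
        {e\<in>E. \<tau> e = j \<and> T e = S} - {e\<in>X. \<tau> e = j \<and> T e = S}"
      using False by (auto simp: T'_def)
    then have "card {e\<in>E. \<tau> e = j \<and> T' e = S} =
        card {e\<in>E. \<tau> e = j \<and> T e = S} - card {e\<in>X. \<tau> e = j \<and> T e = S}"
      using X(1) finX by (simp add: card_Diff_subset Collect_mono_iff subset_iff)
    also have "\<dots> = M j * (N choose (h j - card S)) - s j S"
      using Tt Xt S' S(2) by simp
    \<comment> \<open>Pascal's rule: removing the chosen edges from the class leaves exactly the
      count required after part \<open>Suc t\<close>. If \<open>card S = h j\<close>, nothing is
      removed and both binomial coefficients are 1.\<close>
    also have "\<dots> = M j * ((N - 1) choose (h j - card S))"
    proof (cases "card S < h j")
      case True
      then have "N choose (h j - card S) =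
          ((N - 1) choose (h j - card S - 1)) + ((N - 1) choose (h j - card S))"
        using N(1) by (intro choose_reduce_nat) auto
      then show ?thesis using True by (simp add: s_def algebra_simps)
    next
      case False
      then show ?thesis by (simp add: s_def)
    qed
    finally show ?thesis using N(2) by simp
  qed
  ultimately show ?case by (intro exI[of _ T']) blast
qed

text \<open>For \<open>t = n\<close> the counts contain the factor
  \<open>0 choose (h j - card S)\<close>, which vanishes on incomplete traces. Since every edge lies
  in its own class, no edge has an incomplete trace.\<close>

lemma parts_assignment:
  assumes "finite E"
    and "\<And>l. (\<Sum>e\<in>{e\<in>E. \<kappa> e = l}. h (\<tau> e)) = n * D l"
    and "\<And>j. card {e\<in>E. \<tau> e = j} = M j * (n choose h j)"
  shows "\<exists>T. (\<forall>e\<in>E. T e \<subseteq> {1..n} \<and> card (T e) = h (\<tau> e)) \<and>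
    (\<forall>l. \<forall>i\<in>{1..n}. card {e\<in>E. \<kappa> e = l \<and> i \<in> T e} = D l) \<and>
    (\<forall>j S. S \<subseteq> {1..n} \<longrightarrow> card S = h j \<longrightarrow> card {e\<in>E. \<tau> e = j \<and> T e = S} = M j)"
proof -
  obtain T where T: "\<forall>e\<in>E. T e \<subseteq> {1..n} \<and> card (T e) \<le> h (\<tau> e)"
    "\<forall>l. \<forall>i\<in>{1..n}. card {e\<in>E. \<kappa> e = l \<and> i \<in> T e} = D l"
    "\<forall>j S. S \<subseteq> {1..n} \<longrightarrow> card S \<le> h j \<longrightarrow>
      card {e\<in>E. \<tau> e = j \<and> T e = S} = M j * (0 choose (h j - card S))"
    using parts_assignment_upto[OF assms order_refl] unfolding diff_self_eq_0 by blast
  have "card (T e) = h (\<tau> e)" if "e \<in> E" for e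
  proof -
    have "card {e'\<in>E. \<tau> e' = \<tau> e \<and> T e' = T e} \<noteq> 0" using that assms(1) by auto
    then have "h (\<tau> e) - card (T e) = 0"
      using T(1,3) that by (cases "h (\<tau> e) - card (T e)") auto
    then show ?thesis using T(1) that by (simp add: le_antisym)
  qed
  then show ?thesis using T by (intro exI[of _ T]) auto
qed

text \<open>Here \<open>\<sigma> e\<close> is the kind of the edge, \<open>s (\<sigma> e)\<close>
  the set of parts it meets, and \<open>\<phi> e i\<close> the vertex it uses in part
  \<open>i\<close>. After \<open>t\<close> parts, every pattern \<open>\<psi>\<close> of vertices in
  the treated parts is used equally often by each kind \<open>a\<close>, with one factor
  \<open>q\<close> for each part of \<open>s a\<close> still untreated. To treat the next part, the
  edges meeting it are split equitably into \<open>q\<close> groups with respect to colour and to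
  kind plus pattern.\<close>

lemma vertex_assignment_upto:
  fixes \<kappa> :: "'e \<Rightarrow> 'c" and \<sigma> :: "'e \<Rightarrow> 't" and s :: "'t \<Rightarrow> nat set"
  assumes "finite E" "q \<ge> 1"
    and colour: "\<And>l i. i \<in> {1..n} \<Longrightarrow> card {e\<in>E. \<kappa> e = l \<and> i \<in> s (\<sigma> e)} = q * r l"
    and type: "\<And>a. card {e\<in>E. \<sigma> e = a} = L a * q ^ card (s a \<inter> {1..n})"
    and "t \<le> n"
  shows "\<exists>\<phi>. (\<forall>e i. \<phi> e i \<in> {1..q}) \<and>
    (\<forall>l. \<forall>i\<in>{1..t}. \<forall>u\<in>{1..q}. card {e\<in>E. \<kappa> e = l \<and> i \<in> s (\<sigma> e) \<and> \<phi> e i = u} = r l) \<and>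
    (\<forall>a \<psi>. (\<forall>i\<in>s a \<inter> {1..t}. \<psi> i \<in> {1..q}) \<longrightarrow>
      card {e\<in>E. \<sigma> e = a \<and> (\<forall>i\<in>s a \<inter> {1..t}. \<phi> e i = \<psi> i)} = L a * q ^ card (s a \<inter> {t<..n}))"
  using \<open>t \<le> n\<close>
proof (induction t)
  case 0
  have "{0<..n} = {1..n}" by auto
  then show ?case using assms(2) type by (intro exI[of _ "\<lambda>_ _. 1"]) simp
next
  case (Suc t)
  obtain \<phi> where IH: "\<forall>e i. \<phi> e i \<in> {1..q}"
    "\<forall>l. \<forall>i\<in>{1..t}. \<forall>u\<in>{1..q}. card {e\<in>E. \<kappa> e = l \<and> i \<in> s (\<sigma> e) \<and> \<phi> e i = u} = r l"
    "\<forall>a \<psi>. (\<forall>i\<in>s a \<inter> {1..t}. \<psi> i \<in> {1..q}) \<longrightarrow>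
      card {e\<in>E. \<sigma> e = a \<and> (\<forall>i\<in>s a \<inter> {1..t}. \<phi> e i = \<psi> i)} = L a * q ^ card (s a \<inter> {t<..n})"
    using Suc.IH Suc_leD[OF Suc.prems] by blast
  have \<phi>: "\<phi> e i \<in> {1..q}" for e i using IH(1) by blast
  have \<phi>c: "card {e\<in>E. \<kappa> e = l \<and> i \<in> s (\<sigma> e) \<and> \<phi> e i = u} = r l"
    if "i \<in> {1..t}" "u \<in> {1..q}" for l i u
    using IH(2) that by blast
  have \<phi>t: "card {e\<in>E. \<sigma> e = a \<and> (\<forall>i\<in>s a \<inter> {1..t}. \<phi> e i = \<psi> i)} = L a * q ^ card (s a \<inter> {t<..n})"
    if "\<And>i. i \<in> s a \<inter> {1..t} \<Longrightarrow> \<psi> i \<in> {1..q}" for a \<psi>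
    using IH(3) that by blast
  define E1 where "E1 = {e\<in>E. Suc t \<in> s (\<sigma> e)}"
  \<comment> \<open>The kind of \<open>e\<close> together with its pattern so far. Restricting the
    function makes equality ignore its values at parts that the edge misses or that are still
    untreated.\<close>
  define d where "d e = (\<sigma> e, restrict (\<phi> e) (s (\<sigma> e) \<inter> {1..t}))" for e
  \<comment> \<open>The division is exact: a nonempty class consists of edges meeting part
    \<open>Suc t\<close>, and that untreated part contributes a factor \<open>q\<close> to its
    size.\<close>
  define \<delta> where "\<delta> b = card {e\<in>E1. d e = b} div q" for b
  have d_iff: "d e = (a, restrict \<psi> (s a \<inter> {1..t})) \<longleftrightarrow> \<sigma> e = a \<and> (\<forall>i\<in>s a \<inter> {1..t}. \<phi> e i = \<psi> i)"
    for e a \<psi>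
    by (auto simp: d_def fun_eq_iff restrict_def split: if_splits)
  have card_Suc: "card (s a \<inter> {t<..n}) = Suc (card (s a \<inter> {Suc t<..n}))" if "Suc t \<in> s a" for a
  proof -
    have "s a \<inter> {t<..n} = insert (Suc t) (s a \<inter> {Suc t<..n})" using that Suc.prems by auto
    then show ?thesis by simp
  qed
  have E1_class: "card {e\<in>E1. d e = (a, restrict \<psi> (s a \<inter> {1..t}))} =
      q * (L a * q ^ card (s a \<inter> {Suc t<..n}))"
    if "Suc t \<in> s a" "\<And>i. i \<in> s a \<inter> {1..t} \<Longrightarrow> \<psi> i \<in> {1..q}" for a \<psi>
  proof -
    have "{e\<in>E1. d e = (a, restrict \<psi> (s a \<inter> {1..t}))} =
        {e\<in>E. \<sigma> e = a \<and> (\<forall>i\<in>s a \<inter> {1..t}. \<phi> e i = \<psi> i)}"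
      unfolding d_iff using that(1) by (auto simp: E1_def)
    then show ?thesis using \<phi>t[of a \<psi>] that card_Suc by simp
  qed
  have "card {e\<in>E1. d e = b} = q * \<delta> b" for b
  proof (cases "{e\<in>E1. d e = b} = {}")
    case True
    then show ?thesis unfolding \<delta>_def by (metis card.empty div_0 mult_0_right)
  next
    case False
    then obtain e where e: "e \<in> E1" "b = d e" by auto
    have "q dvd card {e'\<in>E1. d e' = d e}"
      using E1_class[of "\<sigma> e" "\<phi> e"] \<phi> e(1) unfolding d_def[of e] by (auto simp: E1_def)
    then show ?thesis using e(2) by (simp add: \<delta>_def)
  qed
  moreover have "card {e\<in>E1. \<kappa> e = l} = q * r l" for l
  proof -
    have "{e\<in>E1. \<kappa> e = l} = {e\<in>E. \<kappa> e = l \<and> Suc t \<in> s (\<sigma> e)}" by (auto simp: E1_def)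
    then show ?thesis using colour Suc.prems by simp
  qed
  moreover have "finite E1" using assms(1) by (simp add: E1_def)
  ultimately obtain g where g: "\<And>e. e \<in> E1 \<Longrightarrow> g e \<in> {1..q}"
    "\<And>u l. u \<in> {1..q} \<Longrightarrow> card {e\<in>E1. \<kappa> e = l \<and> g e = u} = r l"
    "\<And>u b. u \<in> {1..q} \<Longrightarrow> card {e\<in>E1. d e = b \<and> g e = u} = \<delta> b"
    using equitable_split[of E1 \<kappa> q r d \<delta>] by blast
  \<comment> \<open>Edges that miss part \<open>Suc t\<close> get the default 1, which only keeps
    the values in \<open>{1..q}\<close>.\<close>
  define \<phi>' where "\<phi>' e = (\<phi> e)(Suc t := if e \<in> E1 then g e else 1)" for e
  have "\<phi>' e i \<in> {1..q}" for e i
    using \<phi>[of e i] g(1)[of e] assms(2) by (auto simp: \<phi>'_def)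
  moreover have "card {e\<in>E. \<kappa> e = l \<and> i \<in> s (\<sigma> e) \<and> \<phi>' e i = u} = r l"
    if "i \<in> {1..Suc t}" "u \<in> {1..q}" for l i u
  proof (cases "i = Suc t")
    case True
    then have "{e\<in>E. \<kappa> e = l \<and> i \<in> s (\<sigma> e) \<and> \<phi>' e i = u} = {e\<in>E1. \<kappa> e = l \<and> g e = u}"
      by (auto simp: \<phi>'_def E1_def)
    then show ?thesis using g(2)[OF that(2)] by simp
  next
    case False
    then show ?thesis using \<phi>c[of i u l] that by (auto simp: \<phi>'_def)
  qed
  moreover have "card {e\<in>E. \<sigma> e = a \<and> (\<forall>i\<in>s a \<inter> {1..Suc t}. \<phi>' e i = \<psi> i)} =
      L a * q ^ card (s a \<inter> {Suc t<..n})"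
    if \<psi>: "\<forall>i\<in>s a \<inter> {1..Suc t}. \<psi> i \<in> {1..q}" for a \<psi>
  proof (cases "Suc t \<in> s a")
    case True
    have "s a \<inter> {1..Suc t} = insert (Suc t) (s a \<inter> {1..t})" using True by auto
    then have "(\<forall>i\<in>s a \<inter> {1..Suc t}. \<phi>' e i = \<psi> i) \<longleftrightarrow>
        (\<forall>i\<in>s a \<inter> {1..t}. \<phi> e i = \<psi> i) \<and> (if e \<in> E1 then g e else 1) = \<psi> (Suc t)" for e
      by (auto simp: \<phi>'_def)
    then have "{e\<in>E. \<sigma> e = a \<and> (\<forall>i\<in>s a \<inter> {1..Suc t}. \<phi>' e i = \<psi> i)} =
        {e\<in>E1. d e = (a, restrict \<psi> (s a \<inter> {1..t})) \<and> g e = \<psi> (Suc t)}"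
      unfolding d_iff using True by (auto simp: E1_def)
    moreover have "\<psi> (Suc t) \<in> {1..q}" using \<psi> True by auto
    moreover have "\<delta> (a, restrict \<psi> (s a \<inter> {1..t})) = L a * q ^ card (s a \<inter> {Suc t<..n})"
      unfolding \<delta>_def using E1_class[of a \<psi>] True \<psi> assms(2) by auto
    ultimately show ?thesis using g(3) by (simp only:)
  next
    case False
    moreover have "{1..Suc t} = insert (Suc t) {1..t}" "{t<..n} = insert (Suc t) {Suc t<..n}"
      using Suc.prems by auto
    ultimately have "s a \<inter> {1..Suc t} = s a \<inter> {1..t}" "s a \<inter> {Suc t<..n} = s a \<inter> {t<..n}"
      by (simp_all only: Int_insert_right if_False)
    moreover have "{e\<in>E. \<sigma> e = a \<and> (\<forall>i\<in>s a \<inter> {1..t}. \<phi>' e i = \<psi> i)} =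
        {e\<in>E. \<sigma> e = a \<and> (\<forall>i\<in>s a \<inter> {1..t}. \<phi> e i = \<psi> i)}"
      by (auto simp: \<phi>'_def)
    ultimately show ?thesis using \<phi>t[of a \<psi>] \<psi> by simp
  qed
  ultimately show ?case by (intro exI[of _ \<phi>']) blast
qed

lemma vertex_assignment:
  fixes \<kappa> :: "'e \<Rightarrow> 'c" and \<sigma> :: "'e \<Rightarrow> 't" and s :: "'t \<Rightarrow> nat set"
  assumes "finite E" "q \<ge> 1"
    and "\<And>l i. i \<in> {1..n} \<Longrightarrow> card {e\<in>E. \<kappa> e = l \<and> i \<in> s (\<sigma> e)} = q * r l"
    and "\<And>a. card {e\<in>E. \<sigma> e = a} = L a * q ^ card (s a \<inter> {1..n})"
  shows "\<exists>\<phi>. (\<forall>e i. \<phi> e i \<in> {1..q}) \<and>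
    (\<forall>l. \<forall>i\<in>{1..n}. \<forall>u\<in>{1..q}. card {e\<in>E. \<kappa> e = l \<and> i \<in> s (\<sigma> e) \<and> \<phi> e i = u} = r l) \<and>
    (\<forall>a \<psi>. (\<forall>i\<in>s a \<inter> {1..n}. \<psi> i \<in> {1..q}) \<longrightarrow>
      card {e\<in>E. \<sigma> e = a \<and> (\<forall>i\<in>s a \<inter> {1..n}. \<phi> e i = \<psi> i)} = L a)"
  using vertex_assignment_upto[OF assms order_refl] by simp

section \<open>Transversals\<close>

text \<open>A vertex is a pair of its part and its index there, so injectivity of \<open>fst\<close>
  means at most one vertex from each part. The set \<open>I\<close> of parts is a parameter because
  counting proceeds by adding or omitting a part.\<close>

definition transversals :: "(nat \<Rightarrow> nat) \<Rightarrow> nat set \<Rightarrow> nat \<Rightarrow> (nat \<times> nat) set set" where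
  "transversals p I h = {S. S \<subseteq> (SIGMA i:I. {1..p i}) \<and> inj_on fst S \<and> card S = h}"

lemma inj_on_fst_unique: "inj_on fst S \<Longrightarrow> (i, u) \<in> S \<Longrightarrow> (i, u') \<in> S \<Longrightarrow> u = u'"
  using inj_onD[of fst S "(i, u)" "(i, u')"] by simp

lemma finite_transversal: "finite I \<Longrightarrow> S \<in> transversals p I h \<Longrightarrow> finite S"
  unfolding transversals_def by (auto intro: finite_subset[OF _ finite_SigmaI])

lemma finite_transversals: "finite I \<Longrightarrow> finite (transversals p I h)"
  unfolding transversals_def by (rule finite_subset[of _ "Pow (SIGMA i:I. {1..p i})"]) auto

lemma transversals_0: "finite I \<Longrightarrow> transversals p I 0 = {{}}"
proof (intro equalityI subsetI)
  fix S assume "finite I" "S \<in> transversals p I 0"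
  then have "finite S" by (rule finite_transversal)
  moreover have "card S = 0" using \<open>S \<in> transversals p I 0\<close> by (simp add: transversals_def)
  ultimately show "S \<in> {{}}" by simp
qed (simp add: transversals_def)

lemma transversals_containing:
  assumes "finite I" "i \<notin> I" "u \<in> {1..p i}"
  shows "{S\<in>transversals p (insert i I) (Suc h). (i, u) \<in> S} = insert (i, u) ` transversals p I h"
proof (intro equalityI subsetI)
  fix S assume "S \<in> {S\<in>transversals p (insert i I) (Suc h). (i, u) \<in> S}"
  then have S: "S \<in> transversals p (insert i I) (Suc h)" "(i, u) \<in> S" by auto
  have fin: "finite S" using finite_transversal[OF _ S(1)] assms(1) by simp
  have "S - {(i, u)} \<in> transversals p I h"
    using S fin unfolding transversals_def
    by (auto simp: card_Diff_singleton dest: inj_on_fst_unique intro: inj_on_subset)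
  moreover have "S = insert (i, u) (S - {(i, u)})" using S(2) by auto
  ultimately show "S \<in> insert (i, u) ` transversals p I h" by blast
next
  fix S assume "S \<in> insert (i, u) ` transversals p I h"
  then obtain S' where S': "S = insert (i, u) S'" "S' \<in> transversals p I h" by auto
  have "finite S'" using finite_transversal[OF assms(1) S'(2)] .
  moreover have "\<forall>x\<in>S'. fst x \<noteq> i" using S'(2) assms(2) by (auto simp: transversals_def)
  ultimately show "S \<in> {S\<in>transversals p (insert i I) (Suc h). (i, u) \<in> S}"
    using S' assms(3) by (force simp: transversals_def card_insert_if)
qed

lemma card_transversals_containing:
  assumes "finite I" "i \<notin> I" "u \<in> {1..p i}"
  shows "card {S\<in>transversals p (insert i I) (Suc h). (i, u) \<in> S} = card (transversals p I h)"
proof -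
  have "(i, u) \<notin> S" if "S \<in> transversals p I h" for S
    using that assms(2) by (auto simp: transversals_def)
  then have "inj_on (insert (i, u)) (transversals p I h)"
    by (intro inj_onI) (metis insert_ident)
  then show ?thesis
    unfolding transversals_containing[of I i u p h, OF assms] by (rule card_image)
qed

text \<open>Either part \<open>i\<close> is missed, or one of its \<open>p i\<close> vertices is
  used and the other \<open>h\<close> vertices form a transversal of \<open>I\<close>.\<close>

lemma card_transversals_insert:
  assumes "finite I" "i \<notin> I"
  shows "card (transversals p (insert i I) (Suc h)) =
    card (transversals p I (Suc h)) + p i * card (transversals p I h)"
proof -
  let ?B = "\<lambda>u. {S\<in>transversals p (insert i I) (Suc h). (i, u) \<in> S}"
  have fin: "finite (transversals p (insert i I) (Suc h))"
    using assms(1) by (intro finite_transversals) simp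
  have "transversals p (insert i I) (Suc h) = transversals p I (Suc h) \<union> (\<Union>u\<in>{1..p i}. ?B u)"
  proof (intro equalityI subsetI)
    fix S assume S: "S \<in> transversals p (insert i I) (Suc h)"
    show "S \<in> transversals p I (Suc h) \<union> (\<Union>u\<in>{1..p i}. ?B u)"
    proof (cases "\<exists>u. (i, u) \<in> S")
      case True
      then obtain u where "(i, u) \<in> S" by blast
      moreover from this have "u \<in> {1..p i}" using S by (auto simp: transversals_def)
      ultimately show ?thesis using S by blast
    next
      case False
      then have "S \<in> transversals p I (Suc h)" using S by (auto simp: transversals_def)
      then show ?thesis by blast
    qed
  next
    fix S assume "S \<in> transversals p I (Suc h) \<union> (\<Union>u\<in>{1..p i}. ?B u)"
    then show "S \<in> transversals p (insert i I) (Suc h)" by (auto simp: transversals_def)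
  qed
  moreover have "transversals p I (Suc h) \<inter> (\<Union>u\<in>{1..p i}. ?B u) = {}"
    using assms(2) by (auto simp: transversals_def)
  ultimately have "card (transversals p (insert i I) (Suc h)) =
      card (transversals p I (Suc h)) + card (\<Union>u\<in>{1..p i}. ?B u)"
    using fin finite_transversals[OF assms(1)] by (metis (no_types, lifting) card_Un_disjoint finite_Un)
  also have "card (\<Union>u\<in>{1..p i}. ?B u) = (\<Sum>u\<in>{1..p i}. card (?B u))"
  proof (intro card_UN_disjoint ballI impI)
    fix u u' :: nat assume "u \<noteq> u'"
    then show "?B u \<inter> ?B u' = {}" by (auto simp: transversals_def dest: inj_on_fst_unique)
  qed (use fin in auto)
  also have "\<dots> = p i * card (transversals p I h)"
    using card_transversals_containing[of I i _ p h] assms by simp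
  finally show ?thesis .
qed

text \<open>The recursion for adding a part becomes Pascal's rule with an extra factor
  \<open>q\<close> for each vertex used.\<close>

lemma card_transversals_uniform:
  assumes "finite I" "\<And>i. i \<in> I \<Longrightarrow> p i = q"
  shows "card (transversals p I h) = (card I choose h) * q ^ h"
  using assms
proof (induction I arbitrary: h rule: finite_induct)
  case empty
  have "transversals p {} h = (if h = 0 then {{}} else {})" by (auto simp: transversals_def)
  then show ?case by (cases h) auto
next
  case (insert i I)
  show ?case
  proof (cases h)
    case 0
    then show ?thesis using transversals_0[of "insert i I"] insert.hyps by simp
  next
    case (Suc h')
    then show ?thesis
      using insert by (simp add: card_transversals_insert algebra_simps)
  qed
qed

lemma card_transversals_pos:
  assumes "finite I" "\<And>i. i \<in> I \<Longrightarrow> p i \<ge> 1" "h \<le> card I"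
  shows "card (transversals p I h) > 0"
proof -
  obtain A where A: "A \<subseteq> I" "card A = h"
    using assms(3) by (meson obtain_subset_with_card_n)
  have "(\<lambda>i. (i, 1)) ` A \<in> transversals p I h"
    using A assms(2) by (auto simp: transversals_def inj_on_def card_image)
  then show ?thesis using finite_transversals[OF assms(1)] by (auto simp: card_gt_0_iff)
qed

section \<open>Edges and degrees of the complete multipartite hypergraph\<close>

lemma multipartite_verts_eq: "multipartite_verts n p = (SIGMA i:{1..n}. {1..p i})"
  by (auto simp: multipartite_verts_def part_def)

lemma card_Int_part_le_1_iff:
  assumes "S \<subseteq> (SIGMA i:{1..n}. {1..p i})"
  shows "(\<forall>i\<in>{1..n}. card (S \<inter> part p i) \<le> 1) \<longleftrightarrow> inj_on fst S"
proof -
  have fin: "finite (S \<inter> part p i)" for i by (simp add: part_def)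
  show ?thesis
  proof
    assume *: "\<forall>i\<in>{1..n}. card (S \<inter> part p i) \<le> 1"
    show "inj_on fst S"
    proof (rule inj_onI)
      fix x y assume xy: "x \<in> S" "y \<in> S" "fst x = fst y"
      then have "x \<in> S \<inter> part p (fst x)" "y \<in> S \<inter> part p (fst x)" "fst x \<in> {1..n}"
        using assms by (auto simp: part_def)
      moreover from this * have "card (S \<inter> part p (fst x)) \<le> Suc 0" by auto
      ultimately show "x = y" unfolding card_le_Suc0_iff_eq[OF fin] by blast
    qed
  next
    assume "inj_on fst S"
    then show "\<forall>i\<in>{1..n}. card (S \<inter> part p i) \<le> 1"
      unfolding One_nat_def card_le_Suc0_iff_eq[OF fin] by (auto simp: part_def dest: inj_on_fst_unique)
  qed
qed

lemma hedges_complete_multipartite: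
  "hedges (complete_multipartite n p m h lam) =
    (SIGMA j:{1..m}. transversals p {1..n} (h j) \<times> {1..lam j})"
proof -
  have "S \<in> transversals p {1..n} (h j) \<longleftrightarrow> S \<subseteq> multipartite_verts n p \<and> card S = h j \<and>
      (\<forall>i\<in>{1..n}. card (S \<inter> part p i) \<le> 1)" for S j
    unfolding transversals_def multipartite_verts_eq using card_Int_part_le_1_iff by blast
  then show ?thesis
    by (auto simp: complete_multipartite_def)
qed

lemma hdegree_sub_complete_multipartite:
  assumes "F \<subseteq> hedges (complete_multipartite n p m h lam)"
  shows "hdegree ((complete_multipartite n p m h lam)\<lparr>hedges := F\<rparr>) v =
    card {x\<in>F. v \<in> fst (snd x)}"
proof -
  have "finite F"
    using assms finite_complete_multipartite[of n p m h lam] finite_subset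
    unfolding finite_hypergraph_def by blast
  have "hdegree ((complete_multipartite n p m h lam)\<lparr>hedges := F\<rparr>) v =
      (\<Sum>x\<in>F. count (mset_set (fst (snd x))) v)"
    by (simp add: hdegree_def complete_multipartite_def case_prod_beta)
  also have "\<dots> = (\<Sum>x\<in>F. of_bool (v \<in> fst (snd x)))"
  proof (rule sum.cong)
    fix x assume "x \<in> F"
    then have "finite (fst (snd x))"
      using assms finite_transversal[of "{1..n}" _ p] by (auto simp: hedges_complete_multipartite)
    then show "count (mset_set (fst (snd x))) v = of_bool (v \<in> fst (snd x))"
      by (simp add: count_mset_set')
  qed simp
  also have "\<dots> = card {x\<in>F. v \<in> fst (snd x)}"
    using \<open>finite F\<close> by (simp add: Int_def)
  finally show ?thesis .
qed

lemma is_factor_complete_multipartite_iff: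
  "is_factor (complete_multipartite n p m h lam) r F \<longleftrightarrow>
    F \<subseteq> hedges (complete_multipartite n p m h lam) \<and>
    (\<forall>v\<in>SIGMA i:{1..n}. {1..p i}. card {x\<in>F. v \<in> fst (snd x)} = r)"
proof -
  have "hverts ((complete_multipartite n p m h lam)\<lparr>hedges := F\<rparr>) = (SIGMA i:{1..n}. {1..p i})"
    by (simp add: complete_multipartite_def multipartite_verts_eq)
  then show ?thesis
    unfolding is_factor_def hregular_def
    using hdegree_sub_complete_multipartite[of F n p m h lam] by auto
qed

lemma card_edges_of_type:
  assumes "j \<in> {1..m}"
  shows "card {x\<in>hedges (complete_multipartite n p m h lam). fst x = j} =
    lam j * card (transversals p {1..n} (h j))"
proof -
  have "{x\<in>hedges (complete_multipartite n p m h lam). fst x = j} =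
      {j} \<times> transversals p {1..n} (h j) \<times> {1..lam j}"
    using assms by (auto simp: hedges_complete_multipartite)
  then show ?thesis by (simp add: card_cartesian_product)
qed

text \<open>Removing the vertex from an edge of size \<open>h j\<close> leaves a transversal of size
  \<open>h j - 1\<close> of the other parts; \<open>h j \<ge> 1\<close> keeps this subtraction from
  being truncated.\<close>

lemma card_edges_at_vertex:
  assumes "i \<in> {1..n}" "u \<in> {1..p i}" "\<And>j. j \<in> {1..m} \<Longrightarrow> h j \<ge> 1"
  shows "card {x\<in>hedges (complete_multipartite n p m h lam). (i, u) \<in> fst (snd x)} =
    (\<Sum>j\<in>{1..m}. lam j * card (transversals p ({1..n} - {i}) (h j - 1)))"
proof -
  let ?B = "\<lambda>j. {S\<in>transversals p {1..n} (h j). (i, u) \<in> S}"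
  have "{x\<in>hedges (complete_multipartite n p m h lam). (i, u) \<in> fst (snd x)} =
      (SIGMA j:{1..m}. ?B j \<times> {1..lam j})"
    by (auto simp: hedges_complete_multipartite)
  then have "card {x\<in>hedges (complete_multipartite n p m h lam). (i, u) \<in> fst (snd x)} =
      (\<Sum>j\<in>{1..m}. card (?B j \<times> {1..lam j}))"
    using finite_transversals[of "{1..n}" p] by (simp only: card_SigmaI) (simp add: card_SigmaI)
  also have "\<dots> = (\<Sum>j\<in>{1..m}. lam j * card (transversals p ({1..n} - {i}) (h j - 1)))"
  proof (rule sum.cong)
    fix j assume "j \<in> {1..m}"
    then have "Suc (h j - 1) = h j" using assms(3)[of j] by simp
    moreover have "insert i ({1..n} - {i}) = {1..n}" using assms(1) by auto
    ultimately have "card (?B j) = card (transversals p ({1..n} - {i}) (h j - 1))"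
      using card_transversals_containing[of "{1..n} - {i}" i u p "h j - 1"] assms(2) by simp
    then show "card (?B j \<times> {1..lam j}) = lam j * card (transversals p ({1..n} - {i}) (h j - 1))"
      by (simp add: card_cartesian_product)
  qed simp
  finally show ?thesis .
qed

section \<open>Factorizations of complete multipartite hypergraphs\<close>

text \<open>Abstract edges carrying a colour, a type and a vertex set are matched with the actual
  edges by numbering those of equal type and vertex set as parallel copies. The colour classes then
  become the factors.\<close>

lemma factorizable_complete_multipartiteI:
  fixes \<kappa> \<tau> :: "'e \<Rightarrow> nat" and V :: "'e \<Rightarrow> (nat \<times> nat) set"
  assumes "finite E"
    and E: "\<And>e. e \<in> E \<Longrightarrow> \<kappa> e \<in> {1..k} \<and> \<tau> e \<in> {1..m} \<and> V e \<in> transversals p {1..n} (h (\<tau> e))"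
    and types: "\<And>j S. j \<in> {1..m} \<Longrightarrow> S \<in> transversals p {1..n} (h j) \<Longrightarrow>
      card {e\<in>E. \<tau> e = j \<and> V e = S} = lam j"
    and degrees: "\<And>l v. l \<in> {1..k} \<Longrightarrow> v \<in> (SIGMA i:{1..n}. {1..p i}) \<Longrightarrow>
      card {e\<in>E. \<kappa> e = l \<and> v \<in> V e} = r l"
  shows "factorizable (complete_multipartite n p m h lam) k r"
proof -
  let ?H = "hedges (complete_multipartite n p m h lam)"
  let ?C = "\<lambda>j S. {e\<in>E. \<tau> e = j \<and> V e = S}"
  \<comment> \<open>A numbering of the abstract edges of type \<open>j\<close> on \<open>S\<close>.
    One exists for admissible \<open>j\<close> and \<open>S\<close>, since there are exactly
    \<open>lam j\<close> such edges.\<close>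
  define b where "b j S = (SOME f. bij_betw f (?C j S) {1..lam j})" for j S
  have b: "bij_betw (b j S) (?C j S) {1..lam j}"
    if "j \<in> {1..m}" "S \<in> transversals p {1..n} (h j)" for j S
    unfolding b_def using types[OF that] assms(1)
    by (intro someI_ex[of "\<lambda>f. bij_betw f (?C j S) {1..lam j}"] finite_same_card_bij) auto
  define \<beta> where "\<beta> e = (\<tau> e, V e, b (\<tau> e) (V e) e)" for e
  have inj: "inj_on \<beta> E"
  proof (rule inj_onI)
    fix e e' assume e: "e \<in> E" "e' \<in> E" "\<beta> e = \<beta> e'"
    then have "e \<in> ?C (\<tau> e) (V e)" "e' \<in> ?C (\<tau> e) (V e)"
      "b (\<tau> e) (V e) e = b (\<tau> e) (V e) e'" by (auto simp: \<beta>_def)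
    moreover have "inj_on (b (\<tau> e) (V e)) (?C (\<tau> e) (V e))"
      using b E[OF e(1)] by (auto simp: bij_betw_def)
    ultimately show "e = e'" by (meson inj_onD)
  qed
  have "\<beta> e \<in> ?H" if "e \<in> E" for e
  proof -
    have "b (\<tau> e) (V e) e \<in> {1..lam (\<tau> e)}"
      using bij_betw_apply[OF b[of "\<tau> e" "V e"]] E[OF that] that by blast
    then show ?thesis using E[OF that] by (simp add: hedges_complete_multipartite \<beta>_def)
  qed
  moreover have "x \<in> \<beta> ` E" if x: "x \<in> ?H" for x
  proof -
    obtain j S c where jSc: "x = (j, S, c)" "j \<in> {1..m}" "S \<in> transversals p {1..n} (h j)" "c \<in> {1..lam j}"
      using x unfolding hedges_complete_multipartite by blast
    then have "c \<in> b j S ` ?C j S" using b[of j S] by (simp add: bij_betw_def)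
    then show ?thesis using jSc(1) by (auto simp: \<beta>_def)
  qed
  ultimately have im: "\<beta> ` E = ?H" by blast
  define F where "F l = \<beta> ` {e\<in>E. \<kappa> e = l}" for l
  have "(\<Union>l\<in>{1..k}. F l) = ?H"
    using E unfolding im[symmetric] F_def by blast
  moreover have "disjoint_family_on F {1..k}"
    using inj by (auto simp: disjoint_family_on_def F_def dest: inj_onD)
  moreover have "is_factor (complete_multipartite n p m h lam) (r l) (F l)" if "l \<in> {1..k}" for l
  proof -
    have "card {x\<in>F l. v \<in> fst (snd x)} = r l" if "v \<in> (SIGMA i:{1..n}. {1..p i})" for v
    proof -
      have "{x\<in>F l. v \<in> fst (snd x)} = \<beta> ` {e\<in>E. \<kappa> e = l \<and> v \<in> V e}"
        by (auto simp: F_def \<beta>_def)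
      moreover have "inj_on \<beta> {e\<in>E. \<kappa> e = l \<and> v \<in> V e}"
        using inj by (rule inj_on_subset) auto
      ultimately show ?thesis using degrees[OF \<open>l \<in> {1..k}\<close> that] by (simp add: card_image)
    qed
    moreover have "F l \<subseteq> ?H" using im by (auto simp: F_def)
    ultimately show ?thesis by (simp add: is_factor_complete_multipartite_iff)
  qed
  ultimately show ?thesis
    unfolding factorizable_def factorization_def by blast
qed

lemma image_graph_eq_iff:
  "(\<lambda>i. (i, f i)) ` A = (\<lambda>i. (i, g i)) ` B \<longleftrightarrow> A = B \<and> (\<forall>i\<in>A. f i = g i)"
  by (auto simp: set_eq_iff image_iff)

text \<open>Having one vertex at most in each part, \<open>S\<close> is the graph of a function on
  the parts it meets. In this form it can be compared with the set of parts and the choice of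
  vertices assigned to an abstract edge.\<close>

lemma transversal_eq_graph:
  assumes "S \<in> transversals p I h"
  obtains f where "S = (\<lambda>i. (i, f i)) ` (fst ` S)" "fst ` S \<subseteq> I" "card (fst ` S) = h"
    "\<And>i. i \<in> fst ` S \<Longrightarrow> f i \<in> {1..p i}"
proof
  have S: "S \<subseteq> (SIGMA i:I. {1..p i})" "inj_on fst S" "card S = h"
    using assms by (auto simp: transversals_def)
  let ?f = "\<lambda>i. snd (inv_into S fst i)"
  have f: "(fst x, ?f (fst x)) = x" if "x \<in> S" for x
    using S(2) that by simp
  show "S = (\<lambda>i. (i, ?f i)) ` (fst ` S)"
    unfolding image_image using f by (simp cong: image_cong)
  show "fst ` S \<subseteq> I" "card (fst ` S) = h" using S by (auto simp: card_image)
  show "?f i \<in> {1..p i}" if i: "i \<in> fst ` S" for i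
  proof -
    obtain x where "x \<in> S" "i = fst x" using i by blast
    then have "(i, ?f i) \<in> S" using f by simp
    then show ?thesis using S(1) by blast
  qed
qed

lemma factorizable_complete_multipartite_if:
  assumes "n \<ge> 1" "q \<ge> 1" and p: "\<And>i. i \<in> {1..n} \<Longrightarrow> p i = q"
    and rows: "\<And>l. l \<in> {1..k} \<Longrightarrow> (\<Sum>j\<in>{1..m}. A l j * h j) = n * q * r l"
    and columns: "\<And>j. j \<in> {1..m} \<Longrightarrow> (\<Sum>l\<in>{1..k}. A l j) = lam j * (n choose h j) * q ^ h j"
  shows "factorizable (complete_multipartite n p m h lam) k r"
proof -
  \<comment> \<open>The triple \<open>(l, j, c)\<close> is the \<open>c\<close>-th of the
    \<open>A l j\<close> abstract edges of colour \<open>l\<close> and type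
    \<open>j\<close>.\<close>
  define E where "E = (SIGMA l:{1..k}. SIGMA j:{1..m}. {1..A l j})"
  define \<tau> :: "nat \<times> nat \<times> nat \<Rightarrow> nat" where "\<tau> e = fst (snd e)" for e
  \<comment> \<open>The assignment lemmas quantify over all colours and types. Outside the index
    ranges the classes are empty, so \<open>r'\<close> and \<open>M\<close> are 0 there.\<close>
  define r' where "r' l = (if l \<in> {1..k} then r l else 0)" for l
  define M where "M j = (if j \<in> {1..m} then lam j * q ^ h j else 0)" for j
  have finE: "finite E" by (auto simp: E_def)
  have colour: "(\<Sum>e\<in>{e\<in>E. fst e = l}. h (\<tau> e)) = n * (q * r' l)" for l
  proof (cases "l \<in> {1..k}")
    case True
    then have "{e\<in>E. fst e = l} = Pair l ` (SIGMA j:{1..m}. {1..A l j})" by (auto simp: E_def)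
    then have "(\<Sum>e\<in>{e\<in>E. fst e = l}. h (\<tau> e)) = (\<Sum>x\<in>(SIGMA j:{1..m}. {1..A l j}). h (fst x))"
      by (simp add: sum.reindex inj_on_def \<tau>_def)
    also have "\<dots> = (\<Sum>j\<in>{1..m}. \<Sum>c\<in>{1..A l j}. h j)"
      by (subst sum.Sigma) (auto simp: case_prod_beta)
    finally show ?thesis using True rows by (simp add: r'_def)
  next
    case False
    then have "{e\<in>E. fst e = l} = {}" by (auto simp: E_def)
    then show ?thesis using False by (simp only: r'_def) simp
  qed
  have type: "card {e\<in>E. \<tau> e = j} = M j * (n choose h j)" for j
  proof (cases "j \<in> {1..m}")
    case True
    then have "{e\<in>E. \<tau> e = j} = (\<lambda>(l, c). (l, j, c)) ` (SIGMA l:{1..k}. {1..A l j})"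
      by (auto simp: E_def \<tau>_def image_iff)
    then have "card {e\<in>E. \<tau> e = j} = card (SIGMA l:{1..k}. {1..A l j})"
      by (simp add: card_image inj_on_def)
    also have "\<dots> = (\<Sum>l\<in>{1..k}. A l j)" by simp
    finally show ?thesis using True columns by (simp add: M_def)
  next
    case False
    then have "{e\<in>E. \<tau> e = j} = {}" by (auto simp: E_def \<tau>_def)
    then show ?thesis using False by (simp only: M_def) simp
  qed
  obtain T where T: "\<forall>e\<in>E. T e \<subseteq> {1..n} \<and> card (T e) = h (\<tau> e)"
    and Tc: "\<forall>l. \<forall>i\<in>{1..n}. card {e\<in>E. fst e = l \<and> i \<in> T e} = q * r' l"
    and Tt: "\<forall>j S. S \<subseteq> {1..n} \<longrightarrow> card S = h j \<longrightarrow> card {e\<in>E. \<tau> e = j \<and> T e = S} = M j"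
    using parts_assignment[OF finE colour type] by blast
  define \<sigma> where "\<sigma> e = (\<tau> e, T e)" for e
  \<comment> \<open>A kind is now a type with a set of parts. An admissible kind has
    \<open>M j = lam j * q ^ h j\<close> edges, hence \<open>lam j\<close> for each of its
    \<open>q ^ h j\<close> choices of vertices; the other kinds do not occur.\<close>
  define L where "L a = (if fst a \<in> {1..m} \<and> snd a \<subseteq> {1..n} \<and> card (snd a) = h (fst a)
    then lam (fst a) else 0)" for a :: "nat \<times> nat set"
  have "card {e\<in>E. \<sigma> e = a} = L a * q ^ card (snd a \<inter> {1..n})" for a
  proof (cases "fst a \<in> {1..m} \<and> snd a \<subseteq> {1..n} \<and> card (snd a) = h (fst a)")
    case True
    have "{e\<in>E. \<sigma> e = a} = {e\<in>E. \<tau> e = fst a \<and> T e = snd a}"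
      by (auto simp: \<sigma>_def)
    then have "card {e\<in>E. \<sigma> e = a} = M (fst a)" using True Tt by simp
    then show ?thesis using True by (simp add: L_def M_def Int_absorb2)
  next
    case False
    have "\<tau> e \<in> {1..m}" if "e \<in> E" for e using that by (auto simp: E_def \<tau>_def)
    then have "\<sigma> e \<noteq> a" if "e \<in> E" for e using False T that unfolding \<sigma>_def by fastforce
    then have "{e\<in>E. \<sigma> e = a} = {}" by blast
    moreover have "L a = 0" using False unfolding L_def by (rule if_not_P)
    ultimately show ?thesis by (simp only:) simp
  qed
  moreover have "card {e\<in>E. fst e = l \<and> i \<in> snd (\<sigma> e)} = q * r' l" if "i \<in> {1..n}" for l i
    using Tc that by (simp add: \<sigma>_def)
  ultimately obtain \<phi> where \<phi>: "\<forall>e i. \<phi> e i \<in> {1..q}"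
    and \<phi>c: "\<forall>l. \<forall>i\<in>{1..n}. \<forall>u\<in>{1..q}. card {e\<in>E. fst e = l \<and> i \<in> snd (\<sigma> e) \<and> \<phi> e i = u} = r' l"
    and \<phi>t: "\<forall>a \<psi>. (\<forall>i\<in>snd a \<inter> {1..n}. \<psi> i \<in> {1..q}) \<longrightarrow>
      card {e\<in>E. \<sigma> e = a \<and> (\<forall>i\<in>snd a \<inter> {1..n}. \<phi> e i = \<psi> i)} = L a"
    using vertex_assignment[OF finE assms(2), of n fst snd \<sigma> r' L] by blast
  define V where "V e = (\<lambda>i. (i, \<phi> e i)) ` T e" for e
  show ?thesis
  proof (rule factorizable_complete_multipartiteI[OF finE, where V = V and \<tau> = \<tau> and \<kappa> = fst])
    fix e assume e: "e \<in> E"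
    have "V e \<in> transversals p {1..n} (h (\<tau> e))"
    proof -
      have "T e \<subseteq> {1..n}" "card (T e) = h (\<tau> e)" using T e by auto
      moreover have "\<phi> e i \<in> {1..p i}" if "i \<in> {1..n}" for i
        unfolding p[OF that] using \<phi> by blast
      ultimately show ?thesis
        unfolding transversals_def V_def by (auto simp: inj_on_def card_image)
    qed
    then show "fst e \<in> {1..k} \<and> \<tau> e \<in> {1..m} \<and> V e \<in> transversals p {1..n} (h (\<tau> e))"
      using e by (auto simp: E_def \<tau>_def)
  next
    fix j S assume j: "j \<in> {1..m}" and S: "S \<in> transversals p {1..n} (h j)"
    obtain \<psi> where \<psi>: "S = (\<lambda>i. (i, \<psi> i)) ` (fst ` S)" "fst ` S \<subseteq> {1..n}" "card (fst ` S) = h j"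
      "\<And>i. i \<in> fst ` S \<Longrightarrow> \<psi> i \<in> {1..p i}"
      using transversal_eq_graph[OF S] by blast
    \<comment> \<open>Both vertex sets are graphs of functions, so their equality means the same
      parts and the same vertices chosen in them, which is what \<open>\<phi>t\<close>
      counts.\<close>
    have VS: "V e = S \<longleftrightarrow> T e = fst ` S \<and> (\<forall>i\<in>fst ` S. \<phi> e i = \<psi> i)" for e
      by (subst \<psi>(1)) (auto simp only: V_def image_graph_eq_iff)
    have Int: "snd (j, fst ` S) \<inter> {1..n} = fst ` S" using \<psi>(2) by (simp add: Int_absorb2)
    have "{e\<in>E. \<tau> e = j \<and> V e = S} =
        {e\<in>E. \<sigma> e = (j, fst ` S) \<and> (\<forall>i\<in>snd (j, fst ` S) \<inter> {1..n}. \<phi> e i = \<psi> i)}"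
      unfolding VS Int \<sigma>_def prod.inject conj_assoc ..
    also have "card \<dots> = L (j, fst ` S)"
    proof (rule \<phi>t[rule_format])
      fix i assume "i \<in> snd (j, fst ` S) \<inter> {1..n}"
      then have "i \<in> fst ` S" "i \<in> {1..n}" by simp_all
      then show "\<psi> i \<in> {1..q}" using \<psi>(4)[of i] p[of i] by metis
    qed
    also have "\<dots> = lam j" using j \<psi>(2,3) by (simp add: L_def)
    finally show "card {e\<in>E. \<tau> e = j \<and> V e = S} = lam j" .
  next
    fix l v assume l: "l \<in> {1..k}" and v: "v \<in> (SIGMA i:{1..n}. {1..p i})"
    obtain i u where iu: "v = (i, u)" "i \<in> {1..n}" "u \<in> {1..q}" using v p by auto
    then have "{e\<in>E. fst e = l \<and> v \<in> V e} = {e\<in>E. fst e = l \<and> i \<in> snd (\<sigma> e) \<and> \<phi> e i = u}"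
      by (auto simp: V_def \<sigma>_def)
    then show "card {e\<in>E. fst e = l \<and> v \<in> V e} = r l"
      using \<phi>c iu l by (simp add: r'_def)
  qed
qed

section \<open>Necessity of the conditions, and the equivalence\<close>

lemma sum_card_factors:
  assumes "factorization G k r F" "finite (hedges G)"
  shows "(\<Sum>l\<in>{1..k}. card {x\<in>F l. P x}) = card {x\<in>hedges G. P x}"
proof -
  have F: "(\<Union>l\<in>{1..k}. F l) = hedges G" "disjoint_family_on F {1..k}"
    using assms(1) by (auto simp: factorization_def)
  have "(\<Sum>l\<in>{1..k}. card {x\<in>F l. P x}) = card (\<Union>l\<in>{1..k}. {x\<in>F l. P x})"
  proof (rule card_UN_disjoint[symmetric])
    show "\<forall>l\<in>{1..k}. finite {x\<in>F l. P x}"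
      using F(1) assms(2) by (metis UN_upper finite_subset finite_Collect_conjI Collect_mem_eq)
    show "\<forall>l\<in>{1..k}. \<forall>l'\<in>{1..k}. l \<noteq> l' \<longrightarrow> {x\<in>F l. P x} \<inter> {x\<in>F l'. P x} = {}"
      using F(2) unfolding disjoint_family_on_def by blast
  qed simp
  also have "(\<Union>l\<in>{1..k}. {x\<in>F l. P x}) = {x\<in>hedges G. P x}" using F(1) by blast
  finally show ?thesis .
qed

text \<open>The two sums are the degrees of vertices in parts \<open>i\<close> and
  \<open>i'\<close>. Let \<open>J\<close> be the set of the other parts. Transversals lying within
  \<open>J\<close> contribute equally to both degrees, and the remaining ones contribute a factor
  \<open>p i'\<close> to the first and \<open>p i\<close> to the second. If
  \<open>p i < p i'\<close>, the first degree would be strictly larger.\<close>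

lemma part_sizes_eq_if_equal_degrees:
  fixes p lam h :: "nat \<Rightarrow> nat"
  assumes "m \<ge> 1" "i \<in> {1..n}" "i' \<in> {1..n}"
    and p: "\<And>i. i \<in> {1..n} \<Longrightarrow> p i \<ge> 1"
    and lam: "\<And>j. j \<in> {1..m} \<Longrightarrow> lam j \<ge> 1"
    and h: "\<And>j. j \<in> {1..m} \<Longrightarrow> h j \<in> {2..n}"
    and eq: "(\<Sum>j\<in>{1..m}. lam j * card (transversals p ({1..n} - {i}) (h j - 1))) =
      (\<Sum>j\<in>{1..m}. lam j * card (transversals p ({1..n} - {i'}) (h j - 1)))"
  shows "p i \<ge> p i'"
proof (rule ccontr)
  assume less: "\<not> p i \<ge> p i'"
  then have "i \<noteq> i'" by auto
  define J where "J = {1..n} - {i, i'}"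
  have J: "finite J" "i \<notin> J" "i' \<notin> J" "{1..n} - {i} = insert i' J" "{1..n} - {i'} = insert i J"
    using assms(2,3) \<open>i \<noteq> i'\<close> by (auto simp: J_def)
  have "card J = n - 2"
    using assms(2,3) \<open>i \<noteq> i'\<close> by (simp add: J_def card_Diff_subset)
  have "(\<Sum>j\<in>{1..m}. lam j * card (transversals p (insert i J) (h j - 1))) <
      (\<Sum>j\<in>{1..m}. lam j * card (transversals p (insert i' J) (h j - 1)))"
  proof (rule sum_strict_mono)
    fix j assume j: "j \<in> {1..m}"
    have "h j - 1 = Suc (h j - 2)" using h[OF j] by auto
    \<comment> \<open>Strictness needs a transversal of size \<open>h j - 2\<close> in the
      \<open>n - 2\<close> parts of \<open>J\<close>, which exists because
      \<open>2 \<le> h j \<le> n\<close>.\<close>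
    moreover have "card (transversals p J (h j - 2)) > 0"
      using h[OF j] p \<open>card J = n - 2\<close> J(1) by (intro card_transversals_pos) (auto simp: J_def)
    ultimately show "lam j * card (transversals p (insert i J) (h j - 1)) <
        lam j * card (transversals p (insert i' J) (h j - 1))"
      using lam[OF j] less J(1-3) by (simp add: card_transversals_insert)
  qed (use assms(1) in auto)
  with eq J(4,5) show False by simp
qed

theorem theorem6p2:
  fixes n k m :: nat and p r lam h :: "nat \<Rightarrow> nat"
  assumes "n \<ge> 1" and "k \<ge> 1" and "m \<ge> 1"
    and "\<And>i. i \<in> {1..n} \<Longrightarrow> p i \<ge> 1"
    and "\<And>i. i \<in> {1..k} \<Longrightarrow> r i \<ge> 1"
    and "\<And>j. j \<in> {1..m} \<Longrightarrow> lam j \<ge> 1"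
    and "\<And>j. j \<in> {1..m} \<Longrightarrow> h j \<in> {2..n}"
    and "inj_on h {1..m}"
  shows "factorizable (complete_multipartite n p m h lam) k r \<longleftrightarrow>
    (\<exists>q::nat.
       (\<forall>i\<in>{1..n}. p i = q) \<and>
       (\<Sum>i\<in>{1..k}. r i) = (\<Sum>j\<in>{1..m}. lam j * ((n - 1) choose (h j - 1)) * q ^ (h j - 1)) \<and>
       (\<exists>A :: nat \<Rightarrow> nat \<Rightarrow> nat.
          (\<forall>i\<in>{1..k}. (\<Sum>j\<in>{1..m}. A i j * h j) = n * q * r i) \<and>
          (\<forall>j\<in>{1..m}. (\<Sum>i\<in>{1..k}. A i j) = lam j * (n choose h j) * q ^ h j)))"
proof
  let ?G = "complete_multipartite n p m h lam"
  assume "factorizable ?G k r"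
  then obtain F where F: "factorization ?G k r F" by (auto simp: factorizable_def)
  then have sub: "F l \<subseteq> hedges ?G" if "l \<in> {1..k}" for l
    using that by (auto simp: factorization_def)
  have deg: "card {x\<in>F l. v \<in> fst (snd x)} = r l"
    if "l \<in> {1..k}" "v \<in> (SIGMA i:{1..n}. {1..p i})" for l v
    using F that unfolding factorization_def is_factor_complete_multipartite_iff by blast
  have finG: "finite (hedges ?G)"
    using finite_complete_multipartite by (simp add: finite_hypergraph_def)
  have vertex: "(\<Sum>l\<in>{1..k}. r l) =
      (\<Sum>j\<in>{1..m}. lam j * card (transversals p ({1..n} - {i}) (h j - 1)))" if "i \<in> {1..n}" for i
  proof -
    \<comment> \<open>Every part is nonempty, so its vertex 1 can be used: its degrees in the
      factors add up to its degree in the whole hypergraph.\<close>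
    have "(i, 1) \<in> (SIGMA i:{1..n}. {1..p i})" using that assms(4) by auto
    then have "(\<Sum>l\<in>{1..k}. r l) = (\<Sum>l\<in>{1..k}. card {x\<in>F l. (i, 1) \<in> fst (snd x)})"
      using deg by simp
    also have "\<dots> = card {x\<in>hedges ?G. (i, 1) \<in> fst (snd x)}"
      by (rule sum_card_factors[OF F finG])
    also have "\<dots> = (\<Sum>j\<in>{1..m}. lam j * card (transversals p ({1..n} - {i}) (h j - 1)))"
    proof (rule card_edges_at_vertex[OF that])
      show "1 \<in> {1..p i}" using assms(4)[OF that] by simp
      show "h j \<ge> 1" if "j \<in> {1..m}" for j using assms(7)[OF that] by simp
    qed
    finally show ?thesis .
  qed
  define q where "q = p 1"
  have pq: "p i = q" if "i \<in> {1..n}" for i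
  proof -
    have "p i \<ge> p i'" if "i \<in> {1..n}" "i' \<in> {1..n}" for i i'
    proof (rule part_sizes_eq_if_equal_degrees[of m i n i' p lam h])
      show "(\<Sum>j\<in>{1..m}. lam j * card (transversals p ({1..n} - {i}) (h j - 1))) =
          (\<Sum>j\<in>{1..m}. lam j * card (transversals p ({1..n} - {i'}) (h j - 1)))"
        using vertex[OF that(1)] vertex[OF that(2)] by simp
    qed (use assms(3,4,6,7) that in auto)
    from this[of i 1] this[of 1 i] show ?thesis using that assms(1) by (simp add: q_def)
  qed
  have "(\<Sum>l\<in>{1..k}. r l) = (\<Sum>j\<in>{1..m}. lam j * ((n - 1) choose (h j - 1)) * q ^ (h j - 1))"
    using vertex[of 1] assms(1) pq card_transversals_uniform[of "{1..n} - {1}" p q]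
    by (simp add: mult.assoc)
  moreover define A where "A l j = card {x\<in>F l. fst x = j}" for l j
  have "(\<Sum>j\<in>{1..m}. A l j * h j) = n * q * r l" if l: "l \<in> {1..k}" for l
  proof -
    have finF: "finite (F l)" using sub[OF l] finG by (rule finite_subset)
    have x: "fst x \<in> {1..m}" "fst (snd x) \<subseteq> (SIGMA i:{1..n}. {1..p i})"
      "card (fst (snd x)) = h (fst x)" if "x \<in> F l" for x
    proof -
      have "x \<in> (SIGMA j:{1..m}. transversals p {1..n} (h j) \<times> {1..lam j})"
        using sub[OF l] that unfolding hedges_complete_multipartite by blast
      then show "fst x \<in> {1..m}" "fst (snd x) \<subseteq> (SIGMA i:{1..n}. {1..p i})"
        "card (fst (snd x)) = h (fst x)"
        unfolding transversals_def by (cases x, force)+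
    qed
    \<comment> \<open>Double counting of the incidences in factor \<open>l\<close>: summed over its
      edges they give the row of \<open>A\<close> times the sizes, summed over the
      \<open>n * q\<close> vertices they give \<open>r l\<close> at each.\<close>
    have "(\<Sum>j\<in>{1..m}. A l j * h j) = (\<Sum>j\<in>{1..m}. \<Sum>x\<in>{x\<in>F l. fst x = j}. h (fst x))"
      by (intro sum.cong) (auto simp: A_def)
    also have "\<dots> = (\<Sum>x\<in>F l. h (fst x))"
      using finF x(1) by (intro sum.group) auto
    also have "\<dots> = (\<Sum>x\<in>F l. card (fst (snd x) \<inter> (SIGMA i:{1..n}. {1..p i})))"
      using x(2,3) by (intro sum.cong) (auto simp: Int_absorb2)
    also have "\<dots> = (\<Sum>v\<in>(SIGMA i:{1..n}. {1..p i}). card {x\<in>F l. v \<in> fst (snd x)})"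
      using finF by (intro sum_card_Int_eq) auto
    also have "\<dots> = (\<Sum>v\<in>(SIGMA i:{1..n}. {1..p i}). r l)"
      using deg[OF l] by (intro sum.cong) auto
    also have "\<dots> = n * q * r l"
      using pq by simp
    finally show ?thesis .
  qed
  moreover have "(\<Sum>l\<in>{1..k}. A l j) = lam j * (n choose h j) * q ^ h j" if "j \<in> {1..m}" for j
    unfolding A_def sum_card_factors[OF F finG] card_edges_of_type[OF that]
    using card_transversals_uniform[of "{1..n}" p q] pq by simp
  ultimately show "\<exists>q. (\<forall>i\<in>{1..n}. p i = q) \<and>
       (\<Sum>i\<in>{1..k}. r i) = (\<Sum>j\<in>{1..m}. lam j * ((n - 1) choose (h j - 1)) * q ^ (h j - 1)) \<and>
       (\<exists>A :: nat \<Rightarrow> nat \<Rightarrow> nat.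
          (\<forall>i\<in>{1..k}. (\<Sum>j\<in>{1..m}. A i j * h j) = n * q * r i) \<and>
          (\<forall>j\<in>{1..m}. (\<Sum>i\<in>{1..k}. A i j) = lam j * (n choose h j) * q ^ h j))"
    using pq by blast
next
  assume "\<exists>q::nat.
       (\<forall>i\<in>{1..n}. p i = q) \<and>
       (\<Sum>i\<in>{1..k}. r i) = (\<Sum>j\<in>{1..m}. lam j * ((n - 1) choose (h j - 1)) * q ^ (h j - 1)) \<and>
       (\<exists>A :: nat \<Rightarrow> nat \<Rightarrow> nat.
          (\<forall>i\<in>{1..k}. (\<Sum>j\<in>{1..m}. A i j * h j) = n * q * r i) \<and>
          (\<forall>j\<in>{1..m}. (\<Sum>i\<in>{1..k}. A i j) = lam j * (n choose h j) * q ^ h j))"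
  then obtain q A where "\<forall>i\<in>{1..n}. p i = q"
    "\<forall>i\<in>{1..k}. (\<Sum>j\<in>{1..m}. A i j * h j) = n * q * r i"
    "\<forall>j\<in>{1..m}. (\<Sum>i\<in>{1..k}. A i j) = lam j * (n choose h j) * q ^ h j"
    by blast
  moreover from this have "q \<ge> 1" using assms(1) assms(4)[of 1] by auto
  ultimately show "factorizable (complete_multipartite n p m h lam) k r"
    using assms(1) by (intro factorizable_complete_multipartite_if[where q = q and A = A]) auto
qed

end
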